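(* Let $T$ be a maximal tree of rank $r\geqslant 4$. Then $T$ is obtained from a maximal tree $T'$ of smaller rank in one of the following three ways: (i) $T'$ has rank $r-2$, and $T$ is obtained by attaching a vertex of a $P_2$ to a vertex of $T'$ which is neither pendant nor pre-pendant; (ii) $T'$ has rank $r-2$, and $T$ is obtained by attaching a pendant vertex of a $P_3$ to a pre-pendant vertex of $T'$; (iii) $r\geqslant 8$, $T'$ has rank $r-4$, and $T$ is obtained by attaching a pre-pendant vertex of a $P_5$ to a pre-pendant vertex of $T'$.
   Context: All graphs are finite and simple. The rank of a graph $G$, denoted $\mathrm{rank}(G)$, is the rank (over the reals) of its adjacency matrix. A graph is reduced if it has no isolated vertex and no two distinct vertices with the same set of neighbors (a tree with at least one edge is reduced exactly when no two distinct pendant vertices have the same neighbor). A vertex of degree one is called pendant; a vertex adjacent to a pendant vertex is called pre-pendant. (In $P_2$ both vertices are at once pendant and pre-pendant.) A maximal tree is a reduced tree that is not a proper subgraph of a reduced tree with the same rank. $P_n$ denotes the path graph on $n$ vertices. "Attaching" a vertex $a$ of a path $P$ to a vertex $b$ of a tree $T'$ means taking the disjoint union of $P$ and $T'$ and adding the edge $ab$. *)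

theory Defs
  imports
    "Graph_Theory.Digraph_Component"
    "Jordan_Normal_Form.DL_Rank"
    "HOL-Library.Infinite_Typeclass"
begin

text \<open>
  Finite simple graphs are symmetric loop-free finite digraphs without parallel arcs,
  i.e. \<open>pair_graph\<close>; every edge \<open>{u, v}\<close> is represented by the two arcs \<open>(u, v)\<close> and \<open>(v, u)\<close>.
\<close>

definition neighbors :: "'a pair_pre_digraph \<Rightarrow> 'a \<Rightarrow> 'a set" where
  "neighbors G v = {w. v \<rightarrow>\<^bsub>with_proj G\<^esub> w}"

definition adj_mat :: "'a pair_pre_digraph \<Rightarrow> 'a list \<Rightarrow> real mat" where
  "adj_mat G vs = mat (length vs) (length vs)
     (\<lambda>(i, j). if vs ! i \<rightarrow>\<^bsub>with_proj G\<^esub> vs ! j then 1 else 0)"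

text \<open>
  The rank does not depend on the chosen enumeration of the vertices, since two enumerations
  give adjacency matrices that differ by a simultaneous permutation of rows and columns.
\<close>

definition graph_rank :: "'a pair_pre_digraph \<Rightarrow> nat" where
  "graph_rank G =
     vec_space.rank (card (pverts G))
       (adj_mat G (SOME vs. distinct vs \<and> set vs = pverts G))"

text \<open>
  In a symmetric digraph \<open>u, v, u\<close> counts as a cycle, so the library's \<open>forest\<close> and \<open>tree\<close>
  exclude every graph with an edge. The cycles of length at least 3 are exactly the
  cycles of the undirected graph. The library's \<open>connected\<close> includes nonemptiness.
\<close>

definition simple_tree :: "'a pair_pre_digraph \<Rightarrow> bool" where
  "simple_tree G \<longleftrightarrow> pair_graph G \<and> Digraph_Component.connected (with_proj G) \<and>
     \<not> (\<exists>p. pre_digraph.cycle (with_proj G) p \<and> 3 \<le> length p)"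

definition reduced :: "'a pair_pre_digraph \<Rightarrow> bool" where
  "reduced G \<longleftrightarrow> (\<forall>v\<in>pverts G. neighbors G v \<noteq> {}) \<and>
     (\<forall>u\<in>pverts G. \<forall>v\<in>pverts G. u \<noteq> v \<longrightarrow> neighbors G u \<noteq> neighbors G v)"

text \<open>By symmetry, the out-degree is the degree of the undirected graph.\<close>

definition pendant :: "'a pair_pre_digraph \<Rightarrow> 'a \<Rightarrow> bool" where
  "pendant G v \<longleftrightarrow> v \<in> pverts G \<and> out_degree (with_proj G) v = 1"

definition pre_pendant :: "'a pair_pre_digraph \<Rightarrow> 'a \<Rightarrow> bool" where
  "pre_pendant G v \<longleftrightarrow> v \<in> pverts G \<and> (\<exists>u. pendant G u \<and> v \<rightarrow>\<^bsub>with_proj G\<^esub> u)"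

text \<open>
  The vertex type is infinite so that every finite graph containing a copy of \<open>T\<close> as a
  subgraph is isomorphic to one on the same type containing \<open>T\<close> itself. Over a finite
  type, trees could be maximal merely for lack of further vertices.
\<close>

definition maximal_tree :: "'a::infinite pair_pre_digraph \<Rightarrow> bool" where
  "maximal_tree T \<longleftrightarrow> simple_tree T \<and> reduced T \<and>
     \<not> (\<exists>H. simple_tree H \<and> reduced H \<and> graph_rank H = graph_rank T \<and>
            subgraph (with_proj T) (with_proj H) \<and> T \<noteq> H)"

definition path_graph :: "nat \<Rightarrow> 'a pair_pre_digraph \<Rightarrow> bool" where
  "path_graph n P \<longleftrightarrow> (\<exists>vs. distinct vs \<and> length vs = n \<and> pverts P = set vs \<and>
     parcs P = {(vs ! i, vs ! j) | i j. i < n \<and> j < n \<and> (j = Suc i \<or> i = Suc j)})"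

text \<open>\<open>T\<close> results from attaching the vertex \<open>a\<close> of \<open>P\<close> to the vertex \<open>b\<close> of \<open>T'\<close>.\<close>

definition attaching ::
  "'a pair_pre_digraph \<Rightarrow> 'a pair_pre_digraph \<Rightarrow> 'a \<Rightarrow> 'a pair_pre_digraph \<Rightarrow> 'a \<Rightarrow> bool" where
  "attaching T P a T' b \<longleftrightarrow>
     a \<in> pverts P \<and> b \<in> pverts T' \<and> pverts P \<inter> pverts T' = {} \<and>
     T = \<lparr> pverts = pverts P \<union> pverts T', parcs = parcs P \<union> parcs T' \<union> {(a, b), (b, a)} \<rparr>"

end

theory Submission imports Defs begin

text \<open>
  A maximal tree of rank at least four has a rigid shape. Let \<open>A\<close> be the set of its pre-pendant
  vertices. Every edge meets \<open>A\<close>, each vertex of \<open>A\<close> has exactly one pendant neighbor, and each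
  vertex of \<open>A\<close> has at least two neighbors outside \<open>A\<close>. Conversely, every tree of this shape
  (\<open>core_tree\<close>) is maximal, and its rank is twice the size of \<open>A\<close>. The theorem then amounts to
  cutting an end off such a tree so that the shape survives.

  Maximality gives the shape (\<open>maximal_tree_core\<close>) through null vectors of the adjacency matrix.
  If \<open>v\<close> has no pendant neighbor, hanging a new leaf at \<open>v\<close> leaves the tree reduced, so it must change
  the rank. If the indicator of \<open>v\<close> were in the range of the matrix, the bipartition of the
  tree would allow a solution vanishing at \<open>v\<close>, and the leaf would be invisible to the rank; by the
  Fredholm alternative some null vector is therefore nonzero at \<open>v\<close>. So null vectors detect every
  vertex outside \<open>A\<close>, whereas the equation at a pendant vertex makes them vanish on \<open>A\<close>. Two
  adjacent vertices of a tree cannot both be detected, by a Green identity over one side of the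
  edge between them, so every edge meets \<open>A\<close>. Finally, the equation at a vertex \<open>a\<close> of \<open>A\<close>
  must balance the value at its leaf against a second neighbor outside \<open>A\<close>.

  For the converse (\<open>core_tree_maximal\<close>), null vectors that are nonzero outside \<open>A\<close> can be written
  down explicitly, so a leaf added outside \<open>A\<close> raises the rank. A larger reduced tree cannot
  merely add a second leaf next to an old one: one of the two has a further neighbor, and this
  raises the rank again.

  The end to be cut off is found by looking at a deepest vertex \<open>v0\<close> and the path \<open>v0, v1, v2, v3\<close>
  from it. The shape forces \<open>v1\<close> and \<open>v3\<close> into \<open>A\<close>, keeps \<open>v2\<close> out of it, and leaves \<open>v1\<close> no
  neighbors besides \<open>v0\<close> and \<open>v2\<close>. If \<open>v2\<close> has a third neighbor, cut off \<open>v0, v1\<close>. Otherwise, if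
  \<open>v3\<close> keeps two neighbors outside \<open>A\<close> without \<open>v2\<close>, cut off \<open>v0, v1, v2\<close>. Otherwise the
  neighbors of \<open>v3\<close> are \<open>v2\<close>, a leaf \<open>w\<close>, and by the depth of \<open>v0\<close> at most one vertex of \<open>A\<close>: if
  there is one, cut off the five vertices \<open>v0, v1, v2, v3, w\<close>; if there is none, the tree is a path on five
  vertices and cutting off \<open>v0, v1, v2\<close> leaves a single edge.
\<close>

section \<open>Rank as the size of a column basis\<close>

lemma pair_graph_iff:
  "pair_graph G \<longleftrightarrow> finite (pverts G) \<and>
     (\<forall>a b. (a, b) \<in> parcs G \<longrightarrow>
        a \<in> pverts G \<and> b \<in> pverts G \<and> a \<noteq> b \<and> (b, a) \<in> parcs G)"
proof
  assume "pair_graph G"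
  then interpret pair_graph G .
  show "finite (pverts G) \<and> (\<forall>a b. (a, b) \<in> parcs G \<longrightarrow>
        a \<in> pverts G \<and> b \<in> pverts G \<and> a \<noteq> b \<and> (b, a) \<in> parcs G)"
    using pair_finite_verts wellformed' no_loops' arcs_symmetric by blast
next
  assume *: "finite (pverts G) \<and> (\<forall>a b. (a, b) \<in> parcs G \<longrightarrow>
        a \<in> pverts G \<and> b \<in> pverts G \<and> a \<noteq> b \<and> (b, a) \<in> parcs G)"
  then have "parcs G \<subseteq> pverts G \<times> pverts G" by auto
  with * have "finite (parcs G)" using finite_subset by blast
  with * show "pair_graph G"
    by unfold_locales (auto simp: symmetric_def sym_def)
qed

lemma pair_graphD:
  assumes "pair_graph G"
  shows "finite (pverts G)"
    and "(a, b) \<in> parcs G \<Longrightarrow> a \<in> pverts G"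
    and "(a, b) \<in> parcs G \<Longrightarrow> b \<in> pverts G"
    and "(a, b) \<in> parcs G \<Longrightarrow> a \<noteq> b"
    and "(a, b) \<in> parcs G \<Longrightarrow> (b, a) \<in> parcs G"
  using assms unfolding pair_graph_iff by blast+

lemma neighbors_iff [simp]: "w \<in> neighbors G v \<longleftrightarrow> (v, w) \<in> parcs G"
  by (simp add: neighbors_def)

lemma neighbors_subset: "pair_graph G \<Longrightarrow> neighbors G v \<subseteq> pverts G"
  by (auto dest: pair_graphD)

lemma finite_neighbors: "pair_graph G \<Longrightarrow> finite (neighbors G v)"
  using neighbors_subset finite_subset pair_graphD(1) by metis

text \<open>
  The entry at \<open>i\<close> of the adjacency matrix times \<open>x\<close>. Working with functions on vertices instead of
  vectors avoids any enumeration of the vertex set.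
\<close>

definition neighbor_sum :: "'a pair_pre_digraph \<Rightarrow> ('a \<Rightarrow> real) \<Rightarrow> 'a \<Rightarrow> real" where
  "neighbor_sum G x i = (\<Sum>j\<in>neighbors G i. x j)"

lemma neighbor_sum_supported:
  assumes "finite (neighbors G i)" "finite S" "\<And>j. j \<notin> S \<Longrightarrow> x j = 0"
  shows "neighbor_sum G x i = (\<Sum>j\<in>S. x j * of_bool ((i, j) \<in> parcs G))"
proof -
  have "neighbor_sum G x i = (\<Sum>j\<in>neighbors G i \<inter> S. x j)"
    unfolding neighbor_sum_def using assms by (intro sum.mono_neutral_right) auto
  also have "\<dots> = (\<Sum>j\<in>S. x j * of_bool ((i, j) \<in> parcs G))"
    using assms(2) by (intro sum.mono_neutral_cong_left) auto
  finally show ?thesis .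
qed

lemma neighbor_sum_linear:
  "neighbor_sum G (\<lambda>j. c * x j + d * y j) i = c * neighbor_sum G x i + d * neighbor_sum G y i"
  by (simp add: neighbor_sum_def sum.distrib sum_distrib_left)

definition null_vector :: "'a pair_pre_digraph \<Rightarrow> ('a \<Rightarrow> real) \<Rightarrow> bool" where
  "null_vector G x \<longleftrightarrow> (\<forall>i\<in>pverts G. neighbor_sum G x i = 0)"

text \<open>
  Sets of columns are represented by sets of vertices, and a linear combination of them by a
  coefficient function that vanishes outside the set. Twin vertices give equal columns but stay
  different indices.
\<close>

definition independent_columns :: "'a pair_pre_digraph \<Rightarrow> 'a set \<Rightarrow> bool" where
  "independent_columns G S \<longleftrightarrow> S \<subseteq> pverts G \<and>
     (\<forall>x. (\<forall>j. j \<notin> S \<longrightarrow> x j = 0) \<longrightarrow> null_vector G x \<longrightarrow> (\<forall>j. x j = 0))"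

definition spanning_columns :: "'a pair_pre_digraph \<Rightarrow> 'a set \<Rightarrow> bool" where
  "spanning_columns G S \<longleftrightarrow> (\<forall>j\<in>pverts G. \<exists>x. (\<forall>k. k \<notin> S \<longrightarrow> x k = 0) \<and>
     (\<forall>i\<in>pverts G. neighbor_sum G x i = of_bool ((i, j) \<in> parcs G)))"

lemma neighbor_sum_indicator:
  assumes "pair_graph G"
  shows "neighbor_sum G (\<lambda>k. of_bool (k = j)) i = of_bool ((i, j) \<in> parcs G)"
  using neighbor_sum_supported[of G i "{j}" "\<lambda>k. of_bool (k = j)"] finite_neighbors[OF assms]
  by simp

text \<open>
  The bridge to matrices: a column basis \<open>S\<close> in the above sense becomes, for any enumeration of the
  vertices, a maximal linearly independent subset of the columns of the adjacency matrix, and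
  independence makes the passage from indices to columns injective on \<open>S\<close>. All later
  rank computations use only this characterization.
\<close>

lemma graph_rank_column_basis:
  assumes G: "pair_graph G" and ind: "independent_columns G S" and spn: "spanning_columns G S"
  shows "graph_rank G = card S"
proof -
  define vs where "vs = (SOME vs. distinct vs \<and> set vs = pverts G)"
  have "\<exists>vs. distinct vs \<and> set vs = pverts G"
    using finite_distinct_list[OF pair_graphD(1)[OF G]] by blast
  then have vs: "distinct vs" "set vs = pverts G"
    unfolding vs_def by (metis (mono_tags, lifting) someI_ex)+
  define n where "n = card (pverts G)"
  have n: "length vs = n" using vs distinct_card n_def by metis
  have idx: "\<exists>m<n. vs ! m = i" if "i \<in> pverts G" for i
    using that vs(2) n by (auto simp: in_set_conv_nth)
  define A where "A = adj_mat G vs"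
  have A: "A \<in> carrier_mat n n" by (simp add: A_def adj_mat_def n)
  define f where "f j = vec n (\<lambda>i. of_bool ((vs ! i, j) \<in> parcs G) :: real)" for j
  have fc: "f j \<in> carrier_vec n" for j by (simp add: f_def)
  have colsA: "set (cols A) = f ` pverts G"
  proof -
    have "col A j = f (vs ! j)" if "j < n" for j
      using that by (auto simp: A_def adj_mat_def n f_def)
    moreover have "set (cols A) = col A ` {0..<n}"
      using A by (simp add: cols_def)
    ultimately have "set (cols A) = (\<lambda>j. f (vs ! j)) ` {0..<n}" by auto
    also have "\<dots> = f ` ((!) vs ` {0..<n})" by auto
    also have "(!) vs ` {0..<n} = pverts G"
      using vs n by (metis atLeast0LessThan list.set_map map_nth set_upt)
    finally show ?thesis .
  qed
  have SV: "S \<subseteq> pverts G" using ind by (simp add: independent_columns_def)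
  have finS: "finite S" using SV pair_graphD(1)[OF G] finite_subset by blast
  interpret vec_space "TYPE(real)" n .
  have inj: "inj_on f S"
  proof (rule inj_onI, rule ccontr)
    fix j k assume j: "j \<in> S" "k \<in> S" "f j = f k" "j \<noteq> k"
    define x :: "'a \<Rightarrow> real" where "x l = 1 * of_bool (l = j) + (-1) * of_bool (l = k)" for l
    have "neighbor_sum G x i = 0" if i: "i \<in> pverts G" for i
    proof -
      obtain m where m: "m < n" "vs ! m = i" using idx[OF i] by blast
      have "neighbor_sum G x i = of_bool ((i, j) \<in> parcs G) - of_bool ((i, k) \<in> parcs G)"
        unfolding x_def neighbor_sum_linear neighbor_sum_indicator[OF G] by simp
      also have "\<dots> = f j $ m - f k $ m" using m by (simp add: f_def)
      finally show ?thesis using j by simp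
    qed
    then have "null_vector G x" by (simp add: null_vector_def)
    moreover have "\<forall>l. l \<notin> S \<longrightarrow> x l = 0" using j by (auto simp: x_def)
    ultimately have "x j = 0" using ind unfolding independent_columns_def by blast
    then show False using j by (simp add: x_def)
  qed
  have lc: "lincomb a (f ` S) $ m = neighbor_sum G (\<lambda>j. if j \<in> S then a (f j) else 0) (vs ! m)"
    if "m < n" for a m
  proof -
    have "lincomb a (f ` S) $ m = (\<Sum>v\<in>f ` S. a v * v $ m)"
      using that fc by (intro lincomb_index) auto
    also have "\<dots> = (\<Sum>j\<in>S. a (f j) * f j $ m)" using inj by (simp add: sum.reindex)
    also have "\<dots> = (\<Sum>j\<in>S. (if j \<in> S then a (f j) else 0) * of_bool ((vs ! m, j) \<in> parcs G))"
      using that by (intro sum.cong) (auto simp: f_def)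
    also have "\<dots> = neighbor_sum G (\<lambda>j. if j \<in> S then a (f j) else 0) (vs ! m)"
      by (rule neighbor_sum_supported[symmetric]) (auto simp: finite_neighbors[OF G] finS)
    finally show ?thesis .
  qed
  have li: "lin_indpt (f ` S)"
  proof (rule finite_lin_indpt2)
    show "finite (f ` S)" using finS by simp
    show "f ` S \<subseteq> carrier_vec n" using fc by auto
    fix a assume 0: "lincomb a (f ` S) = 0\<^sub>v n"
    define x where "x j = (if j \<in> S then a (f j) else 0)" for j
    have "neighbor_sum G x i = 0" if i: "i \<in> pverts G" for i
    proof -
      obtain m where m: "m < n" "vs ! m = i" using idx[OF i] by blast
      show ?thesis using lc[OF m(1), of a] 0 m unfolding x_def by simp
    qed
    then have "null_vector G x" by (simp add: null_vector_def)
    moreover have "\<forall>l. l \<notin> S \<longrightarrow> x l = 0" by (auto simp: x_def)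
    ultimately have x0: "\<forall>j. x j = 0" using ind unfolding independent_columns_def by blast
    have "a (f j) = 0" if "j \<in> S" for j using x0[rule_format, of j] that by (simp add: x_def)
    then show "\<forall>v\<in>f ` S. a v = 0" by auto
  qed
  have span: "f j \<in> span (f ` S)" if j: "j \<in> pverts G" for j
  proof -
    obtain x where x: "\<forall>k. k \<notin> S \<longrightarrow> x k = 0"
      "\<forall>i\<in>pverts G. neighbor_sum G x i = of_bool ((i, j) \<in> parcs G)"
      using spn j unfolding spanning_columns_def by blast
    define a where "a v = x (the_inv_into S f v)" for v
    have xa: "(\<lambda>j. if j \<in> S then a (f j) else 0) = x"
      using x(1) the_inv_into_f_f[OF inj] by (auto simp: a_def)
    have "f j = lincomb a (f ` S)"
    proof (rule eq_vecI)
      have "lincomb a (f ` S) \<in> carrier_vec n" using fc by (intro lincomb_closed) auto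
      then show dv: "dim_vec (f j) = dim_vec (lincomb a (f ` S))" by (simp add: f_def)
      fix m assume "m < dim_vec (lincomb a (f ` S))"
      then have m: "m < n" using dv by (simp add: f_def)
      then have "vs ! m \<in> pverts G" using vs n by (metis nth_mem)
      then show "f j $ m = lincomb a (f ` S) $ m"
        unfolding lc[OF m] xa using x(2) m by (simp add: f_def)
    qed
    moreover have "f ` S \<subseteq> carrier_vec n" using fc by auto
    ultimately show ?thesis using finS by (auto simp: finite_span)
  qed
  have "maximal (f ` S) (\<lambda>T. T \<subseteq> set (cols A) \<and> lin_indpt T)"
    unfolding maximal_def
  proof (intro conjI allI impI)
    show "f ` S \<subseteq> set (cols A)" using SV colsA by auto
    show "lin_indpt (f ` S)" by (rule li)
    fix T assume T: "f ` S \<subseteq> T \<and> T \<subseteq> set (cols A) \<and> lin_indpt T"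
    show "T = f ` S"
    proof (rule ccontr)
      assume "T \<noteq> f ` S"
      then obtain t where t: "t \<in> T" "t \<notin> f ` S" using T by blast
      then have "t \<in> span (f ` S)" using T colsA span by auto
      then have "lin_dep (f ` S \<union> {t})"
        using lin_dep_iff_in_span[of "f ` S" t] li t T fc colsA by auto
      moreover have "f ` S \<union> {t} \<subseteq> T" using T t by auto
      ultimately show False using T subset_li_is_li by blast
    qed
  qed
  then have "rank A = card (f ` S)" by (rule rank_card_indpt[OF A])
  also have "\<dots> = card S" by (rule card_image[OF inj])
  finally show ?thesis unfolding graph_rank_def A_def vs_def n_def .
qed

text \<open>
  A maximal independent set spans: if column \<open>j\<close> cannot be added, then \<open>j\<close> has a nonzero coefficient
  in some dependency, which can be solved for column \<open>j\<close>.
\<close>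

lemma independent_columns_extend:
  assumes G: "pair_graph G" and ind: "independent_columns G S"
  shows "\<exists>B. S \<subseteq> B \<and> independent_columns G B \<and> spanning_columns G B"
proof -
  have fin: "finite (pverts G)" by (rule pair_graphD(1)[OF G])
  obtain B where B: "maximal B (independent_columns G)" "S \<subseteq> B"
    using maximal_exists_superset[OF fin, of "independent_columns G" S] ind
    by (auto simp: independent_columns_def)
  have Bi: "independent_columns G B" using B by (simp add: maximal_def)
  have "spanning_columns G B"
    unfolding spanning_columns_def
  proof
    fix j assume j: "j \<in> pverts G"
    show "\<exists>x. (\<forall>k. k \<notin> B \<longrightarrow> x k = 0) \<and>
     (\<forall>i\<in>pverts G. neighbor_sum G x i = of_bool ((i, j) \<in> parcs G))"
    proof (cases "j \<in> B")
      case True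
      then show ?thesis
        using neighbor_sum_indicator[OF G] by (intro exI[of _ "\<lambda>k. of_bool (k = j)"]) auto
    next
      case False
      then have "\<not> independent_columns G (insert j B)" using B unfolding maximal_def by blast
      then obtain x where x: "\<forall>k. k \<notin> insert j B \<longrightarrow> x k = 0" "null_vector G x" "\<exists>k. x k \<noteq> 0"
        using Bi j unfolding independent_columns_def by auto
      have xj: "x j \<noteq> 0"
      proof
        assume "x j = 0"
        then have "\<forall>k. k \<notin> B \<longrightarrow> x k = 0" using x(1) by auto
        then show False using Bi x unfolding independent_columns_def by blast
      qed
      define y where "y k = (- 1 / x j) * x k + 1 * of_bool (k = j)" for k
      have "y k = 0" if "k \<notin> B" for k
        using x(1) xj that by (auto simp: y_def)
      moreover have "neighbor_sum G y i = of_bool ((i, j) \<in> parcs G)" if "i \<in> pverts G" for i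
        unfolding y_def neighbor_sum_linear neighbor_sum_indicator[OF G]
        using x(2) that by (simp add: null_vector_def)
      ultimately show ?thesis by blast
    qed
  qed
  with B Bi show ?thesis by blast
qed

lemma column_basis_exists:
  assumes "pair_graph G"
  shows "\<exists>B. independent_columns G B \<and> spanning_columns G B"
  using independent_columns_extend[OF assms, of "{}"]
  by (auto simp: independent_columns_def)

lemma card_independent_columns_le_rank:
  assumes G: "pair_graph G" and S: "independent_columns G S"
  shows "card S \<le> graph_rank G"
proof -
  obtain B where B: "S \<subseteq> B" "independent_columns G B" "spanning_columns G B"
    using independent_columns_extend[OF G S] by blast
  then have "finite B"
    using pair_graphD(1)[OF G] finite_subset unfolding independent_columns_def by blast
  then show ?thesis using graph_rank_column_basis[OF G B(2,3)] card_mono B(1) by metis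
qed

section \<open>Rank of induced subgraphs and removal of pendant pairs\<close>

lemma neighbor_sum_transfer:
  assumes "finite (neighbors G i)" "finite (neighbors H i)"
    and "\<And>j. x j \<noteq> 0 \<Longrightarrow> (i, j) \<in> parcs G \<longleftrightarrow> (i, j) \<in> parcs H"
  shows "neighbor_sum G x i = neighbor_sum H x i"
proof -
  have "neighbor_sum G x i = (\<Sum>j\<in>neighbors G i \<inter> neighbors H i. x j)"
    unfolding neighbor_sum_def using assms by (intro sum.mono_neutral_right) auto
  also have "\<dots> = neighbor_sum H x i"
    unfolding neighbor_sum_def using assms by (intro sum.mono_neutral_left) auto
  finally show ?thesis .
qed

lemma neighbor_sum_over_vertices:
  assumes G: "pair_graph G"
  shows "neighbor_sum G x i = (\<Sum>j\<in>pverts G. x j * of_bool ((i, j) \<in> parcs G))"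
  unfolding neighbor_sum_def using neighbors_subset[OF G, of i] pair_graphD(1)[OF G]
  by (intro sum.mono_neutral_cong_left) auto

lemma independent_columns_induced:
  assumes G: "pair_graph G" and H: "pair_graph H" and sub: "pverts G \<subseteq> pverts H"
    and ind: "\<And>a b. a \<in> pverts G \<Longrightarrow> b \<in> pverts G \<Longrightarrow> (a, b) \<in> parcs H \<longleftrightarrow> (a, b) \<in> parcs G"
    and S: "independent_columns G S"
  shows "independent_columns H S"
  unfolding independent_columns_def
proof (intro conjI allI impI)
  have SV: "S \<subseteq> pverts G" using S by (simp add: independent_columns_def)
  then show "S \<subseteq> pverts H" using sub by simp
  fix x :: "'a \<Rightarrow> real" and j
  assume x: "\<forall>j. j \<notin> S \<longrightarrow> x j = 0" "null_vector H x"
  have "neighbor_sum G x i = neighbor_sum H x i" if "i \<in> pverts G" for i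
    using that x(1) SV ind
    by (intro neighbor_sum_transfer finite_neighbors G H) blast
  then have "null_vector G x" using x(2) sub by (auto simp: null_vector_def)
  then show "x j = 0" using S x(1) unfolding independent_columns_def by blast
qed

lemma graph_rank_induced_le:
  assumes "pair_graph G" "pair_graph H" "pverts G \<subseteq> pverts H"
    and "\<And>a b. a \<in> pverts G \<Longrightarrow> b \<in> pverts G \<Longrightarrow> (a, b) \<in> parcs H \<longleftrightarrow> (a, b) \<in> parcs G"
  shows "graph_rank G \<le> graph_rank H"
proof -
  obtain B where B: "independent_columns G B" "spanning_columns G B"
    using column_basis_exists[OF assms(1)] by blast
  have "independent_columns H B"
    using independent_columns_induced[OF assms] B(1) by blast
  then show ?thesis
    using card_independent_columns_le_rank[OF assms(2)] graph_rank_column_basis[OF assms(1) B]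
    by simp
qed

lemma pair_pre_digraph_eqI:
  fixes G H :: "'a pair_pre_digraph"
  assumes "pverts G = pverts H" "\<And>a b. (a, b) \<in> parcs G \<longleftrightarrow> (a, b) \<in> parcs H"
  shows "G = H"
proof -
  have "parcs G = parcs H" using assms(2) by auto
  then show ?thesis using assms(1) by (intro pair_pre_digraph.equality) auto
qed

definition delete_vertices :: "'a pair_pre_digraph \<Rightarrow> 'a set \<Rightarrow> 'a pair_pre_digraph" where
  "delete_vertices G X = \<lparr>pverts = pverts G - X, parcs = {(a, b) \<in> parcs G. a \<notin> X \<and> b \<notin> X}\<rparr>"

lemma delete_vertices_simps [simp]:
  "pverts (delete_vertices G X) = pverts G - X"
  "(a, b) \<in> parcs (delete_vertices G X) \<longleftrightarrow> (a, b) \<in> parcs G \<and> a \<notin> X \<and> b \<notin> X"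
  by (auto simp: delete_vertices_def)

lemma delete_vertices_delete_vertices [simp]:
  "delete_vertices (delete_vertices G X) Y = delete_vertices G (X \<union> Y)"
  by (auto simp: delete_vertices_def)

lemma pair_graph_delete_vertices: "pair_graph G \<Longrightarrow> pair_graph (delete_vertices G X)"
  by (auto simp: pair_graph_iff)

definition add_leaf :: "'a pair_pre_digraph \<Rightarrow> 'a \<Rightarrow> 'a \<Rightarrow> 'a pair_pre_digraph" where
  "add_leaf G p w = \<lparr>pverts = insert w (pverts G), parcs = parcs G \<union> {(p, w), (w, p)}\<rparr>"

lemma add_leaf_simps [simp]:
  "pverts (add_leaf G p w) = insert w (pverts G)"
  "(a, b) \<in> parcs (add_leaf G p w) \<longleftrightarrow> (a, b) \<in> parcs G \<or> (a, b) = (p, w) \<or> (a, b) = (w, p)"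
  by (auto simp: add_leaf_def)

lemma pair_graph_add_leaf:
  "pair_graph G \<Longrightarrow> p \<in> pverts G \<Longrightarrow> w \<notin> pverts G \<Longrightarrow> pair_graph (add_leaf G p w)"
  by (auto simp: pair_graph_iff)

lemma leaf_arc: "neighbors G u = {v} \<Longrightarrow> (u, v) \<in> parcs G"
  by (simp flip: neighbors_iff)

lemma leaf_in_pverts: "pair_graph G \<Longrightarrow> neighbors G u = {v} \<Longrightarrow> u \<in> pverts G"
  by (rule pair_graphD(2)[OF _ leaf_arc])

lemma leaf_arc_unique: "neighbors G u = {v} \<Longrightarrow> (u, w) \<in> parcs G \<Longrightarrow> w = v"
  by (simp flip: neighbors_iff)

lemma neighbors_eq_singletonI:
  assumes "(u, v) \<in> parcs G" "\<And>w. (u, w) \<in> parcs G \<Longrightarrow> w = v"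
  shows "neighbors G u = {v}"
proof -
  have "w \<in> neighbors G u \<longleftrightarrow> w \<in> {v}" for w using assms(1) assms(2)[of w] by auto
  then show ?thesis by (simp add: set_eq_iff)
qed

text \<open>
  Column \<open>u\<close> is the indicator of \<open>v\<close>, and row \<open>u\<close> reads off the coefficient of \<open>v\<close>. Hence a column basis
  of the remaining graph becomes a column basis of the whole graph by adding \<open>u\<close> and \<open>v\<close>: row \<open>u\<close>
  removes \<open>v\<close> from any dependency, row \<open>v\<close> then removes \<open>u\<close>, and in a spanning argument column \<open>u\<close>
  corrects row \<open>v\<close> at will.
\<close>

lemma graph_rank_delete_pendant_pair:
  assumes G: "pair_graph G" and u: "neighbors G u = {v}"
  shows "graph_rank G = graph_rank (delete_vertices G {u, v}) + 2"
proof -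
  let ?H = "delete_vertices G {u, v}"
  have H: "pair_graph ?H" by (rule pair_graph_delete_vertices[OF G])
  have "v \<in> neighbors G u" using u by simp
  then have "(u, v) \<in> parcs G" by simp
  then have uv: "(u, v) \<in> parcs G" "(v, u) \<in> parcs G" "u \<noteq> v" "u \<in> pverts G" "v \<in> pverts G"
    using pair_graphD[OF G] by blast+
  have uw: "w = v" if "(u, w) \<in> parcs G" for w using that u by (simp flip: neighbors_iff)
  have wu: "w = v" if "(w, u) \<in> parcs G" for w using that uw pair_graphD(5)[OF G] by blast
  obtain B where B: "independent_columns ?H B" "spanning_columns ?H B"
    using column_basis_exists[OF H] by blast
  have BV: "B \<subseteq> pverts G - {u, v}" using B by (simp add: independent_columns_def)
  have finB: "finite B" using BV pair_graphD(1)[OF G] by (meson finite_Diff finite_subset)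
  \<comment> \<open>The equation at the leaf.\<close>
  have at_u: "neighbor_sum G x u = x v" for x by (simp add: neighbor_sum_def u)
  have "independent_columns G (insert u (insert v B))"
    unfolding independent_columns_def
  proof (intro conjI allI impI)
    show "insert u (insert v B) \<subseteq> pverts G" using uv BV by auto
    fix x :: "'a \<Rightarrow> real" and j
    assume x: "\<forall>j. j \<notin> insert u (insert v B) \<longrightarrow> x j = 0" "null_vector G x"
    have xv: "x v = 0" using x(2) uv at_u[of x] by (simp add: null_vector_def)
    define x' where "x' k = (if k = u then 0 else x k)" for k
    have "neighbor_sum ?H x' i = 0" if i: "i \<in> pverts ?H" for i
    proof -
      have "neighbor_sum ?H x' i = neighbor_sum G x' i"
        using i xv by (intro neighbor_sum_transfer finite_neighbors G H) (auto simp: x'_def split: if_splits)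
      also have "\<dots> = neighbor_sum G x i"
        unfolding neighbor_sum_def using i wu by (intro sum.cong) (auto simp: x'_def)
      finally show ?thesis using x(2) i by (simp add: null_vector_def)
    qed
    then have "null_vector ?H x'" by (simp add: null_vector_def)
    moreover have "\<forall>k. k \<notin> B \<longrightarrow> x' k = 0" using x(1) xv by (auto simp: x'_def)
    ultimately have x'0: "\<forall>k. x' k = 0" using B(1) unfolding independent_columns_def by blast
    then have x0: "x k = 0" if "k \<noteq> u" for k using that by (metis x'_def)
    have "neighbor_sum G x v = x u"
      using neighbor_sum_supported[of G v "{u}" x] x0 finite_neighbors[OF G] uv by simp
    then have "x u = 0" using x(2) uv by (simp add: null_vector_def)
    then show "x j = 0" using x0 by metis
  qed
  moreover have "spanning_columns G (insert u (insert v B))"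
    unfolding spanning_columns_def
  proof
    fix j assume j: "j \<in> pverts G"
    show "\<exists>x. (\<forall>k. k \<notin> insert u (insert v B) \<longrightarrow> x k = 0) \<and>
      (\<forall>i\<in>pverts G. neighbor_sum G x i = of_bool ((i, j) \<in> parcs G))"
    proof (cases "j \<in> {u, v}")
      case True
      then show ?thesis
        using neighbor_sum_indicator[OF G] by (intro exI[of _ "\<lambda>k. of_bool (k = j)"]) auto
    next
      case False
      then have "j \<in> pverts ?H" using j by simp
      then obtain x where x: "\<forall>k. k \<notin> B \<longrightarrow> x k = 0"
        "\<forall>i\<in>pverts ?H. neighbor_sum ?H x i = of_bool ((i, j) \<in> parcs ?H)"
        using B(2) unfolding spanning_columns_def by blast
      \<comment> \<open>The error in row \<open>v\<close>; column \<open>u\<close> corrects it.\<close>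
      define c where "c = of_bool ((v, j) \<in> parcs G) - neighbor_sum G x v"
      define y where "y k = 1 * x k + c * of_bool (k = u)" for k
      have "y k = 0" if "k \<notin> insert u (insert v B)" for k
        using that x(1) by (simp add: y_def)
      moreover have "neighbor_sum G y i = of_bool ((i, j) \<in> parcs G)" if i: "i \<in> pverts G" for i
      proof -
        have y: "neighbor_sum G y i = neighbor_sum G x i + c * of_bool ((i, u) \<in> parcs G)"
          unfolding y_def neighbor_sum_linear neighbor_sum_indicator[OF G] by simp
        consider "i = u" | "i = v" | "i \<in> pverts ?H" using i by auto
        then show ?thesis
        proof cases
          case 1
          have "x v = 0" using x(1) BV by blast
          then show ?thesis using 1 y at_u uw False pair_graphD(4)[OF G] by auto
        next
          case 2
          then show ?thesis using y uv by (simp add: c_def)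
        next
          case 3
          then have "(i, u) \<notin> parcs G" using wu by auto
          moreover have "neighbor_sum G x i = neighbor_sum ?H x i"
            using 3 x(1) BV by (intro neighbor_sum_transfer finite_neighbors G H) auto
          ultimately show ?thesis using y 3 x(2) False by auto
        qed
      qed
      ultimately show ?thesis by blast
    qed
  qed
  ultimately have "graph_rank G = card (insert u (insert v B))"
    by (rule graph_rank_column_basis[OF G])
  also have "\<dots> = card B + 2" using BV uv finB by (auto simp: card_insert_if)
  finally show ?thesis using graph_rank_column_basis[OF H B] by simp
qed

lemma graph_rank_no_arcs:
  assumes G: "pair_graph G" and "parcs G = {}"
  shows "graph_rank G = 0"
proof -
  have "independent_columns G {}" by (auto simp: independent_columns_def)
  moreover have "spanning_columns G {}"
    using assms(2) by (auto simp: spanning_columns_def neighbor_sum_def)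
  ultimately show ?thesis using graph_rank_column_basis[OF G] by fastforce
qed

text \<open>
  Removing the vertices of \<open>A\<close> one by one, each together with its leaf, ends in a graph without
  edges, and every removal costs two.
\<close>

lemma graph_rank_private_leaves:
  assumes "pair_graph G" "A \<subseteq> pverts G"
    and "\<And>a b. (a, b) \<in> parcs G \<Longrightarrow> a \<in> A \<or> b \<in> A"
    and "\<And>a. a \<in> A \<Longrightarrow> \<exists>l. l \<notin> A \<and> neighbors G l = {a}"
  shows "graph_rank G = 2 * card A"
proof -
  have "finite A" using assms(1,2) pair_graphD(1) finite_subset by blast
  then show ?thesis using assms
  proof (induction A arbitrary: G rule: finite_induct)
    case empty
    then show ?case using graph_rank_no_arcs[of G] by force
  next
    case (insert a A)
    obtain l where l: "l \<notin> insert a A" "neighbors G l = {a}" using insert.prems(4) by blast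
    let ?H = "delete_vertices G {l, a}"
    have "graph_rank ?H = 2 * card A"
    proof (rule insert.IH)
      show "pair_graph ?H" by (rule pair_graph_delete_vertices) (rule insert.prems)
      show "A \<subseteq> pverts ?H" using insert.prems(2) insert.hyps l by auto
      show "b \<in> A \<or> c \<in> A" if "(b, c) \<in> parcs ?H" for b c
        using that insert.prems(3)[of b c] by auto
      fix b assume b: "b \<in> A"
      then obtain m where m: "m \<notin> insert a A" "neighbors G m = {b}"
        using insert.prems(4)[of b] by blast
      have "b \<noteq> l" "b \<noteq> a" using b l(1) insert.hyps by auto
      have "m \<noteq> l" using m(2) l(2) \<open>b \<noteq> a\<close> by (metis singleton_inject)
      have "c \<in> neighbors ?H m \<longleftrightarrow> c \<in> neighbors G m \<and> c \<noteq> l \<and> c \<noteq> a" for c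
        using \<open>m \<noteq> l\<close> m(1) by auto
      then have "neighbors ?H m = {b}" unfolding m(2) using \<open>b \<noteq> l\<close> \<open>b \<noteq> a\<close> by blast
      then show "\<exists>m. m \<notin> A \<and> neighbors ?H m = {b}" using m by blast
    qed
    then show ?case
      using graph_rank_delete_pendant_pair[OF insert.prems(1) l(2)] insert.hyps by simp
  qed
qed

section \<open>Null vectors and adding a leaf\<close>

text \<open>
  Discrete Green identity: edges inside \<open>S\<close> contribute symmetrically to both sums, so only the edges
  leaving \<open>S\<close> survive. It is used with \<open>S\<close> the whole vertex set, where it says that the adjacency
  matrix is symmetric, and with \<open>S\<close> one side of an edge of a tree.
\<close>

lemma neighbor_sum_Green:
  assumes G: "pair_graph G" and S: "finite S"
  shows "(\<Sum>i\<in>S. x i * neighbor_sum G y i) - (\<Sum>i\<in>S. y i * neighbor_sum G x i)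
    = (\<Sum>(i, j)\<in>{(i, j) \<in> parcs G. i \<in> S \<and> j \<notin> S}. x i * y j - y i * x j)"
proof -
  let ?in = "{(i, j) \<in> parcs G. i \<in> S \<and> j \<in> S}"
  let ?out = "{(i, j) \<in> parcs G. i \<in> S \<and> j \<notin> S}"
  have "parcs G \<subseteq> pverts G \<times> pverts G" using pair_graphD[OF G] by auto
  then have fin: "finite (parcs G)"
    using pair_graphD(1)[OF G] finite_subset by (metis finite_cartesian_product)
  have fin': "finite ?in" "finite ?out" using fin by (auto intro: finite_subset[OF _ fin])
  have split: "(\<Sum>i\<in>S. f i * neighbor_sum G g i) =
      (\<Sum>(i, j)\<in>?in. f i * g j) + (\<Sum>(i, j)\<in>?out. f i * g j)" for f g :: "'a \<Rightarrow> real"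
  proof -
    have "(\<Sum>i\<in>S. f i * neighbor_sum G g i) = (\<Sum>i\<in>S. \<Sum>j\<in>neighbors G i. f i * g j)"
      by (simp add: neighbor_sum_def sum_distrib_left)
    also have "\<dots> = (\<Sum>(i, j)\<in>(SIGMA i:S. neighbors G i). f i * g j)"
      by (rule sum.Sigma) (auto simp: S finite_neighbors[OF G])
    also have "(SIGMA i:S. neighbors G i) = ?in \<union> ?out" by auto
    also have "(\<Sum>(i, j)\<in>?in \<union> ?out. f i * g j) =
        (\<Sum>(i, j)\<in>?in. f i * g j) + (\<Sum>(i, j)\<in>?out. f i * g j)"
      using fin' by (intro sum.union_disjoint) auto
    finally show ?thesis .
  qed
  have "(\<Sum>(i, j)\<in>?in. x i * y j) = (\<Sum>(i, j)\<in>?in. y i * x j)"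
    by (rule sum.reindex_bij_witness[of _ prod.swap prod.swap])
      (auto dest: pair_graphD(5)[OF G])
  then show ?thesis
    unfolding split by (simp add: sum_subtractf case_prod_unfold)
qed

lemma neighbor_sum_symmetric:
  assumes G: "pair_graph G"
  shows "(\<Sum>i\<in>pverts G. x i * neighbor_sum G y i) = (\<Sum>i\<in>pverts G. y i * neighbor_sum G x i)"
proof -
  have "{(i, j) \<in> parcs G. i \<in> pverts G \<and> j \<notin> pverts G} = {}" using pair_graphD[OF G] by auto
  then show ?thesis
    using neighbor_sum_Green[OF G pair_graphD(1)[OF G], of x y] by (simp only: sum.empty)
qed

lemma neighbor_sum_add_leaf:
  assumes G: "pair_graph G" and v: "v \<in> pverts G" "w \<notin> pverts G" and i: "i \<in> pverts G"
  shows "neighbor_sum (add_leaf G v w) y i = neighbor_sum G y i + of_bool (i = v) * y w"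
proof (cases "i = v")
  case True
  have "neighbors (add_leaf G v w) i = insert w (neighbors G i)" using True v i by auto
  moreover have "w \<notin> neighbors G i" using v pair_graphD(3)[OF G] by auto
  ultimately show ?thesis
    using True finite_neighbors[OF G] by (simp add: neighbor_sum_def)
next
  case False
  then have "neighbors (add_leaf G v w) i = neighbors G i" using v i by auto
  then show ?thesis using False by (simp add: neighbor_sum_def)
qed

lemma neighbor_sum_add_leaf_new:
  assumes G: "pair_graph G" and v: "v \<in> pverts G" "w \<notin> pverts G"
  shows "neighbor_sum (add_leaf G v w) y w = y v"
proof -
  have "neighbors (add_leaf G v w) w = {v}" using v pair_graphD(2)[OF G] by auto
  then show ?thesis by (simp add: neighbor_sum_def)
qed

text \<open>
  The new column is the indicator of \<open>v\<close> on the old vertices. Everything in the range of a symmetric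
  matrix is orthogonal to its null vectors, but this column is not orthogonal to \<open>x\<close>; so it is
  independent of the old ones.
\<close>

lemma graph_rank_add_leaf_greater:
  assumes G: "pair_graph G" and v: "v \<in> pverts G" "w \<notin> pverts G"
    and x: "null_vector G x" "x v \<noteq> 0"
  shows "graph_rank G < graph_rank (add_leaf G v w)"
proof -
  let ?H = "add_leaf G v w"
  have H: "pair_graph ?H" by (rule pair_graph_add_leaf[OF G v])
  obtain B where B: "independent_columns G B" "spanning_columns G B"
    using column_basis_exists[OF G] by blast
  have BV: "B \<subseteq> pverts G" using B by (simp add: independent_columns_def)
  have finB: "finite B" using BV pair_graphD(1)[OF G] by (meson finite_subset)
  have "independent_columns ?H (insert w B)"
    unfolding independent_columns_def
  proof (intro conjI allI impI)
    show "insert w B \<subseteq> pverts ?H" using BV by auto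
    fix y :: "'a \<Rightarrow> real" and j
    assume y: "\<forall>j. j \<notin> insert w B \<longrightarrow> y j = 0" "null_vector ?H y"
    have eq: "neighbor_sum G y i = - (of_bool (i = v) * y w)" if "i \<in> pverts G" for i
      using neighbor_sum_add_leaf[OF G v that, of y] y(2) that by (auto simp: null_vector_def)
    have "0 = (\<Sum>i\<in>pverts G. y i * neighbor_sum G x i)"
      using x(1) by (simp add: null_vector_def)
    also have "\<dots> = (\<Sum>i\<in>pverts G. x i * neighbor_sum G y i)"
      by (rule neighbor_sum_symmetric[OF G])
    also have "\<dots> = (\<Sum>i\<in>pverts G. if i = v then - (x i * y w) else 0)"
      by (intro sum.cong) (auto simp: eq)
    also have "\<dots> = - (x v * y w)" using v pair_graphD(1)[OF G] by simp
    finally have yw: "y w = 0" using x(2) by simp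
    then have "null_vector G y" using eq by (auto simp: null_vector_def)
    moreover have "\<forall>j. j \<notin> B \<longrightarrow> y j = 0" using y(1) yw by auto
    ultimately show "y j = 0" using B(1) unfolding independent_columns_def by blast
  qed
  then have "card (insert w B) \<le> graph_rank ?H"
    by (rule card_independent_columns_le_rank[OF H])
  moreover have "w \<notin> B" using BV v by auto
  ultimately show ?thesis using graph_rank_column_basis[OF G B] finB by simp
qed

text \<open>
  A column basis of \<open>G\<close> remains one after adding the leaf. By symmetry the hypothesis on \<open>y\<close> says that
  the new row is the combination of the old rows with coefficients \<open>y\<close>, so every old linear relation
  between columns also holds in the new row. Likewise the new column is the
  combination of the old ones with coefficients \<open>y\<close>; in the new row this combination gives \<open>y v\<close>,
  which has to be zero because the new vertex has no loop.
\<close>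

lemma graph_rank_add_leaf_same:
  assumes G: "pair_graph G" and v: "v \<in> pverts G" "w \<notin> pverts G"
    and y: "\<And>i. i \<in> pverts G \<Longrightarrow> neighbor_sum G y i = of_bool (i = v)" "y v = 0"
  shows "graph_rank (add_leaf G v w) = graph_rank G"
proof -
  let ?H = "add_leaf G v w" and ?V = "pverts G"
  have H: "pair_graph ?H" by (rule pair_graph_add_leaf[OF G v])
  have finV: "finite ?V" by (rule pair_graphD(1)[OF G])
  obtain B where B: "independent_columns G B" "spanning_columns G B"
    using column_basis_exists[OF G] by blast
  have BV: "B \<subseteq> ?V" using B by (simp add: independent_columns_def)
  obtain X where X: "\<And>j k. j \<in> ?V \<Longrightarrow> k \<notin> B \<Longrightarrow> X j k = 0"
    "\<And>i j. j \<in> ?V \<Longrightarrow> i \<in> ?V \<Longrightarrow> neighbor_sum G (X j) i = of_bool ((i, j) \<in> parcs G)"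
    using B(2) unfolding spanning_columns_def by metis
  have col: "(\<Sum>i\<in>?V. z i * of_bool ((k, i) \<in> parcs G)) = neighbor_sum G z k"
    if "k \<in> ?V" for z :: "'a \<Rightarrow> real" and k
    by (rule neighbor_sum_over_vertices[OF G, symmetric])
  \<comment> \<open>The coefficient functions of the old columns also satisfy the equation in the new row, which reads off the value at \<open>v\<close>.\<close>
  have Xv: "X j v = of_bool (j = v)" if j: "j \<in> ?V" for j
  proof -
    have "X j v = (\<Sum>i\<in>?V. if i = v then X j i else 0)" using v finV by simp
    also have "\<dots> = (\<Sum>i\<in>?V. X j i * neighbor_sum G y i)"
      by (intro sum.cong) (auto simp: y)
    also have "\<dots> = (\<Sum>i\<in>?V. y i * neighbor_sum G (X j) i)"
      by (rule neighbor_sum_symmetric[OF G])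
    also have "\<dots> = (\<Sum>i\<in>?V. y i * of_bool ((j, i) \<in> parcs G))"
      using X(2)[OF j] pair_graphD(5)[OF G] by (intro sum.cong) auto
    also have "\<dots> = of_bool (j = v)" using col[OF j, of y] y(1)[OF j] by simp
    finally show ?thesis .
  qed
  have "independent_columns ?H B"
    using v pair_graphD[OF G] by (intro independent_columns_induced[OF G H _ _ B(1)]) auto
  moreover have "spanning_columns ?H B"
    unfolding spanning_columns_def
  proof
    fix j assume j: "j \<in> pverts ?H"
    show "\<exists>x. (\<forall>k. k \<notin> B \<longrightarrow> x k = 0) \<and>
      (\<forall>i\<in>pverts ?H. neighbor_sum ?H x i = of_bool ((i, j) \<in> parcs ?H))"
    proof (cases "j = w")
      case False
      then have jV: "j \<in> ?V" using j by simp
      have "X j w = 0" using X(1)[OF jV] BV v by blast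
      then have "neighbor_sum ?H (X j) i = of_bool ((i, j) \<in> parcs ?H)" if "i \<in> pverts ?H" for i
        using that neighbor_sum_add_leaf[OF G v, of i "X j"] neighbor_sum_add_leaf_new[OF G v, of "X j"]
          X(2)[OF jV, of i] Xv[OF jV] False v jV pair_graphD(2)[OF G]
        by (cases "i = w") auto
      then show ?thesis using X(1)[OF jV] by blast
    next
      case True
      define z where "z k = (\<Sum>j\<in>?V. y j * X j k)" for k
      have z0: "z k = 0" if "k \<notin> B" for k using X(1) that by (simp add: z_def)
      have zG: "neighbor_sum G z i = of_bool (i = v)" if i: "i \<in> ?V" for i
      proof -
        have "neighbor_sum G z i = (\<Sum>j\<in>?V. y j * neighbor_sum G (X j) i)"
          unfolding neighbor_sum_def z_def by (subst sum.swap) (simp add: sum_distrib_left)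
        also have "\<dots> = (\<Sum>j\<in>?V. y j * of_bool ((i, j) \<in> parcs G))"
          using X(2) i by (intro sum.cong) auto
        finally show ?thesis using col[OF i, of y] y(1)[OF i] by simp
      qed
      have "z v = (\<Sum>j\<in>?V. if j = v then y j else 0)"
        unfolding z_def by (intro sum.cong) (auto simp: Xv)
      then have zv: "z v = 0" using v finV y(2) by simp
      have "z w = 0" using z0 BV v by blast
      then have "neighbor_sum ?H z i = of_bool ((i, j) \<in> parcs ?H)" if "i \<in> pverts ?H" for i
        using that neighbor_sum_add_leaf[OF G v, of i z] neighbor_sum_add_leaf_new[OF G v, of z]
          zG[of i] zv True v pair_graphD(2,3)[OF G]
        by (cases "i = w") auto
      then show ?thesis using z0 by blast
    qed
  qed
  ultimately have "graph_rank ?H = card B" by (rule graph_rank_column_basis[OF H])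
  then show ?thesis using graph_rank_column_basis[OF G B] by simp
qed

text \<open>
  Induction on the columns. If \<open>x\<close> is orthogonal to the old columns, but neither to \<open>b\<close> nor to the new column,
  then subtracting a multiple of the new column makes \<open>b\<close> orthogonal to \<open>x\<close>, and the induction
  hypothesis is applied to the difference. A vector obtained in this way as second alternative is
  corrected by a multiple of \<open>x\<close> so as to become orthogonal to the new column, too.
\<close>

lemma fredholm_alternative:
  fixes c :: "'j \<Rightarrow> 'i \<Rightarrow> real"
  assumes "finite J" "finite I"
  shows "(\<exists>y. \<forall>i\<in>I. (\<Sum>j\<in>J. y j * c j i) = b i) \<or>
    (\<exists>x. (\<forall>j\<in>J. (\<Sum>i\<in>I. x i * c j i) = 0) \<and> (\<Sum>i\<in>I. x i * b i) \<noteq> 0)"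
  using assms(1)
proof (induction J arbitrary: b rule: finite_induct)
  case empty
  show ?case
  proof (cases "\<forall>i\<in>I. b i = 0")
    case False
    then obtain i where "i \<in> I" "b i \<noteq> 0" by blast
    moreover have "(\<Sum>k\<in>I. of_bool (k = i) * b k) = (\<Sum>k\<in>I. if k = i then b k else 0)"
      by (intro sum.cong) auto
    ultimately have "(\<Sum>k\<in>I. of_bool (k = i) * b k) \<noteq> 0"
      using assms(2) by simp
    then have "\<exists>x. (\<Sum>k\<in>I. x k * b k) \<noteq> 0" by (intro exI[of _ "\<lambda>k. of_bool (k = i)"])
    then show ?thesis by simp
  qed simp
next
  case (insert j J)
  have extend: "\<exists>y. \<forall>i\<in>I. (\<Sum>k\<in>insert j J. y k * c k i) = b' i + s * c j i"
    if sol: "\<forall>i\<in>I. (\<Sum>k\<in>J. y k * c k i) = b' i" for y b' s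
  proof -
    have "(\<Sum>k\<in>insert j J. (y(j := s)) k * c k i) = b' i + s * c j i" if "i \<in> I" for i
    proof -
      have "(\<Sum>k\<in>J. (y(j := s)) k * c k i) = (\<Sum>k\<in>J. y k * c k i)"
        using insert.hyps by (intro sum.cong) auto
      then show ?thesis using insert.hyps sol that by simp
    qed
    then show ?thesis by blast
  qed
  show ?case
  proof (cases "\<exists>y. \<forall>i\<in>I. (\<Sum>j\<in>J. y j * c j i) = b i")
    case True
    then show ?thesis using extend[of _ b 0] by auto
  next
    case False
    then obtain x where x: "\<forall>j\<in>J. (\<Sum>i\<in>I. x i * c j i) = 0" "(\<Sum>i\<in>I. x i * b i) \<noteq> 0"
      using insert.IH[of b] by blast
    define d where "d = (\<Sum>i\<in>I. x i * c j i)"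
    show ?thesis
    proof (cases "d = 0")
      case True
      then show ?thesis using x d_def by auto
    next
      case False
      define s where "s = (\<Sum>i\<in>I. x i * b i) / d"
      consider y where "\<forall>i\<in>I. (\<Sum>k\<in>J. y k * c k i) = b i - s * c j i"
        | x' where "\<forall>j\<in>J. (\<Sum>i\<in>I. x' i * c j i) = 0" "(\<Sum>i\<in>I. x' i * (b i - s * c j i)) \<noteq> 0"
        using insert.IH[of "\<lambda>i. b i - s * c j i"] by blast
      then show ?thesis
      proof cases
        case (1 y)
        then show ?thesis using extend[of y "\<lambda>i. b i - s * c j i" s] by simp
      next
        case (2 x')
        define t where "t = (\<Sum>i\<in>I. x' i * c j i) / d"
        define z where "z i = x' i - t * x i" for i
        have z: "(\<Sum>i\<in>I. z i * f i) = (\<Sum>i\<in>I. x' i * f i) - t * (\<Sum>i\<in>I. x i * f i)" for f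
          by (simp add: z_def left_diff_distrib sum_subtractf sum_distrib_left mult.assoc)
        have "(\<Sum>i\<in>I. z i * c k i) = 0" if "k \<in> insert j J" for k
          using that 2(1) x(1) False unfolding z by (auto simp: t_def d_def)
        moreover have "(\<Sum>i\<in>I. x' i * (b i - s * c j i)) =
            (\<Sum>i\<in>I. x' i * b i) - s * (\<Sum>i\<in>I. x' i * c j i)"
          by (simp add: right_diff_distrib sum_subtractf sum_distrib_left mult.left_commute)
        then have "(\<Sum>i\<in>I. z i * b i) = (\<Sum>i\<in>I. x' i * (b i - s * c j i))"
          unfolding z by (simp add: t_def s_def)
        ultimately show ?thesis using 2(2) by metis
      qed
    qed
  qed
qed

lemma null_vector_or_column_equation:
  assumes G: "pair_graph G" and v: "v \<in> pverts G"
  shows "(\<exists>x. null_vector G x \<and> x v \<noteq> 0) \<or>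
    (\<exists>y. \<forall>i\<in>pverts G. neighbor_sum G y i = of_bool (i = v))"
proof -
  let ?V = "pverts G"
  have finV: "finite ?V" by (rule pair_graphD(1)[OF G])
  have row: "(\<Sum>j\<in>?V. z j * of_bool ((i, j) \<in> parcs G)) = neighbor_sum G z i"
    for z :: "'a \<Rightarrow> real" and i
    by (rule neighbor_sum_over_vertices[OF G, symmetric])
  have sym: "of_bool ((i, j) \<in> parcs G) = (of_bool ((j, i) \<in> parcs G) :: real)" for i j
    using pair_graphD(5)[OF G] by auto
  consider y where "\<forall>i\<in>?V. ((\<Sum>j\<in>?V. y j * of_bool ((i, j) \<in> parcs G)) :: real) = of_bool (i = v)"
    | x where "\<forall>j\<in>?V. (\<Sum>i\<in>?V. x i * of_bool ((i, j) \<in> parcs G)) = (0 :: real)"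
      "(\<Sum>i\<in>?V. x i * of_bool (i = v)) \<noteq> 0"
    using fredholm_alternative[OF finV finV, of "\<lambda>j i. of_bool ((i, j) \<in> parcs G)" "\<lambda>i. of_bool (i = v)"]
    by blast
  then show ?thesis
  proof cases
    case (1 y)
    then show ?thesis unfolding row by blast
  next
    case (2 x)
    have "(\<Sum>i\<in>?V. x i * of_bool (i = v)) = (\<Sum>i\<in>?V. if i = v then x i else 0)"
      by (intro sum.cong) auto
    then have "x v \<noteq> 0" using 2(2) v finV by simp
    moreover have "null_vector G x"
      using 2(1) unfolding null_vector_def sym[of _ "_ :: 'a"] by (metis (no_types, lifting) row sum.cong sym)
    ultimately show ?thesis by blast
  qed
qed

section \<open>Trees grown leaf by leaf\<close>

text \<open>
  Trees with a chosen first vertex. Properties that survive the addition of a leaf are then proved by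
  induction, and the first vertex can be any vertex of the tree.
\<close>

inductive grown :: "'a \<Rightarrow> 'a pair_pre_digraph \<Rightarrow> bool" for r where
  single: "grown r \<lparr>pverts = {r}, parcs = {}\<rparr>"
| leaf: "grown r G \<Longrightarrow> p \<in> pverts G \<Longrightarrow> w \<notin> pverts G \<Longrightarrow> grown r (add_leaf G p w)"

lemma grown_root: "grown r G \<Longrightarrow> r \<in> pverts G"
  by (induction rule: grown.induct) auto

lemma grown_pair_graph: "grown r G \<Longrightarrow> pair_graph G"
  by (induction rule: grown.induct) (auto simp: pair_graph_add_leaf pair_graph_iff)

text \<open>
  Connectedness in the form that is convenient for induction.
\<close>

lemma grown_cut:
  assumes "grown r G" "S \<inter> pverts G \<noteq> {}" "\<not> pverts G \<subseteq> S"
  shows "\<exists>a b. (a, b) \<in> parcs G \<and> a \<in> S \<and> b \<notin> S"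
  using assms
proof (induction rule: grown.induct)
  case (leaf G p w)
  show ?case
  proof (cases "S \<inter> pverts G \<noteq> {} \<and> \<not> pverts G \<subseteq> S")
    case True
    then obtain a b where "(a, b) \<in> parcs G" "a \<in> S" "b \<notin> S" using leaf.IH by blast
    then show ?thesis by (intro exI[of _ a] exI[of _ b]) simp
  next
    case False
    then consider "p \<in> S" "w \<notin> S" | "p \<notin> S" "w \<in> S" using leaf by auto
    then show ?thesis
    proof cases
      case 1
      then show ?thesis by (intro exI[of _ p] exI[of _ w]) simp
    next
      case 2
      then show ?thesis by (intro exI[of _ w] exI[of _ p]) simp
    qed
  qed
qed auto

text \<open>
  Acyclicity in the form that is convenient for induction: each edge is a bridge, and \<open>S\<close> is the side
  of \<open>u\<close> when the edge is removed.
\<close>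

lemma grown_bridge:
  assumes "grown r G" "(u, v) \<in> parcs G"
  shows "\<exists>S \<subseteq> pverts G. u \<in> S \<and> v \<notin> S \<and>
    (\<forall>a b. (a, b) \<in> parcs G \<longrightarrow> a \<in> S \<longrightarrow> b \<notin> S \<longrightarrow> a = u \<and> b = v)"
  using assms
proof (induction rule: grown.induct)
  case (leaf G p w)
  have G: "pair_graph G" by (rule grown_pair_graph) fact
  have wG: "(a, b) \<in> parcs G \<Longrightarrow> a \<noteq> w \<and> b \<noteq> w" for a b
    using pair_graphD(2,3)[OF G] leaf.hyps by blast
  consider "(u, v) \<in> parcs G" | "u = p" "v = w" | "u = w" "v = p" using leaf.prems by auto
  then show ?case
  proof cases
    case 1
    then obtain S where S: "S \<subseteq> pverts G" "u \<in> S" "v \<notin> S"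
      "\<And>a b. (a, b) \<in> parcs G \<Longrightarrow> a \<in> S \<Longrightarrow> b \<notin> S \<Longrightarrow> a = u \<and> b = v"
      using leaf.IH by blast
    let ?S = "if p \<in> S then insert w S else S"
    have "w \<notin> S" using S(1) leaf.hyps by blast
    have uv: "u \<noteq> w" "v \<noteq> w" using wG[OF 1] by auto
    show ?thesis
    proof (intro exI[of _ ?S] conjI allI impI)
      show "?S \<subseteq> pverts (add_leaf G p w)" using S(1) by auto
      show "u \<in> ?S" "v \<notin> ?S" using S uv by auto
      fix a b assume ab: "(a, b) \<in> parcs (add_leaf G p w)" "a \<in> ?S" "b \<notin> ?S"
      then have "(a, b) \<in> parcs G" using \<open>w \<notin> S\<close> by (auto split: if_splits)
      moreover from this have "a \<in> S" "b \<notin> S" using ab wG by (auto split: if_splits)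
      ultimately show "a = u" "b = v" using S(4) by blast+
    qed
  next
    case 2
    then show ?thesis
      using leaf.hyps wG pair_graphD(2,3)[OF G] by (intro exI[of _ "pverts G"]) auto
  next
    case 3
    then show ?thesis using leaf.hyps wG by (intro exI[of _ "{w}"]) auto
  qed
qed auto

text \<open>
  The distance from a root is the model: adjacent vertices lie on consecutive levels, and a vertex
  has at most one neighbor on the level above it. The parity of the level is a proper two-coloring.
\<close>

definition depth_function :: "'a pair_pre_digraph \<Rightarrow> ('a \<Rightarrow> nat) \<Rightarrow> bool" where
  "depth_function G h \<longleftrightarrow>
    (\<forall>a b. (a, b) \<in> parcs G \<longrightarrow> h a = Suc (h b) \<or> h b = Suc (h a)) \<and>
    (\<forall>a b c. (a, b) \<in> parcs G \<longrightarrow> (a, c) \<in> parcs G \<longrightarrow>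
       h a = Suc (h b) \<longrightarrow> h a = Suc (h c) \<longrightarrow> b = c)"

lemma depth_functionD:
  assumes "depth_function G h" "(a, b) \<in> parcs G"
  shows "h a = Suc (h b) \<or> h b = Suc (h a)"
    and "(a, c) \<in> parcs G \<Longrightarrow> h a = Suc (h b) \<Longrightarrow> h a = Suc (h c) \<Longrightarrow> b = c"
  using assms unfolding depth_function_def by blast+

lemma grown_depth:
  assumes "grown r G"
  shows "\<exists>h. depth_function G h"
  using assms
proof (induction rule: grown.induct)
  case (leaf G p w)
  have G: "pair_graph G" by (rule grown_pair_graph) fact
  have wG: "(a, b) \<in> parcs G \<Longrightarrow> a \<noteq> w \<and> b \<noteq> w" for a b
    using pair_graphD(2,3)[OF G] leaf.hyps by blast
  obtain h where h: "depth_function G h" using leaf.IH by blast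
  define k where "k = h(w := Suc (h p))"
  have pw: "p \<noteq> w" using leaf.hyps by auto
  have kw: "k w = Suc (h p)" and kh: "a \<noteq> w \<Longrightarrow> k a = h a" for a by (auto simp: k_def)
  have kp: "k p = h p" using kh pw by blast
  have "k a = Suc (k b) \<or> k b = Suc (k a)" if "(a, b) \<in> parcs (add_leaf G p w)" for a b
    using that depth_functionD(1)[OF h, of a b] wG[of a b] kw kh[of a] kh[of b] kp by auto
  moreover have "b = c" if "(a, b) \<in> parcs (add_leaf G p w)" "(a, c) \<in> parcs (add_leaf G p w)"
    "k a = Suc (k b)" "k a = Suc (k c)" for a b c
  proof (cases "a = w")
    case True
    then show ?thesis using that(1,2) wG by auto
  next
    case False
    have "x \<noteq> w" if x: "(a, x) \<in> parcs (add_leaf G p w)" "k a = Suc (k x)" for x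
    proof
      assume "x = w"
      then have "a = p" using x(1) False wG[of a x] by auto
      then show False using x(2) \<open>x = w\<close> kw kp by simp
    qed
    then have "b \<noteq> w" "c \<noteq> w" using that by blast+
    moreover from this have "(a, b) \<in> parcs G" "(a, c) \<in> parcs G" using that(1,2) False by simp_all
    ultimately show ?thesis using that(3,4) depth_functionD(2)[OF h, of a b c] kh False by simp
  qed
  ultimately show ?case unfolding depth_function_def by blast
qed (simp add: depth_function_def)

lemma pcas_cut:
  "pcas u q v \<Longrightarrow> u \<in> S \<Longrightarrow> v \<notin> S \<Longrightarrow> \<exists>(a, b)\<in>set q. a \<in> S \<and> b \<notin> S"
proof (induction q arbitrary: u)
  case (Cons e q)
  then show ?case by (cases "snd e \<in> S") (auto simp: case_prod_unfold)
qed auto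

lemma pcas_end_in_pawalk_verts: "pcas u q v \<Longrightarrow> v \<in> set (pawalk_verts u q)"
  by (induction q arbitrary: u) auto

lemma fst_in_pawalk_verts: "e \<in> set q \<Longrightarrow> fst e \<in> set (pawalk_verts u q)"
  by (induction q arbitrary: u) auto

lemma pawalk_verts_subset:
  "u \<in> W \<Longrightarrow> fst ` set q \<subseteq> W \<Longrightarrow> snd ` set q \<subseteq> W \<Longrightarrow> set (pawalk_verts u q) \<subseteq> W"
  by (induction q arbitrary: u) auto

lemma simple_tree_pair_graph: "simple_tree G \<Longrightarrow> pair_graph G"
  by (simp add: simple_tree_def)

lemma connected_iff_reachable:
  assumes "pair_graph G"
  shows "Digraph_Component.connected (with_proj G) \<longleftrightarrow>
    pverts G \<noteq> {} \<and> (\<forall>u\<in>pverts G. \<forall>v\<in>pverts G. u \<rightarrow>\<^sup>*\<^bsub>with_proj G\<^esub> v)"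
proof -
  have "(parcs G)\<^sup>s = parcs G" using pair_graphD(5)[OF assms] by (auto simp: symcl_def)
  then show ?thesis by (simp add: connected_conv reachable_def)
qed

text \<open>
  A cycle of length at least three that starts with the edge from \<open>u\<close> to \<open>v\<close> must return to the side of
  \<open>u\<close> through the same edge. Since vertices do not repeat on it, it would go back at
  once and have length two.
\<close>

lemma grown_simple_tree:
  assumes "grown r G"
  shows "simple_tree G"
proof -
  have G: "pair_graph G" by (rule grown_pair_graph[OF assms])
  interpret pair_graph G by (rule G)
  have "u \<rightarrow>\<^sup>*\<^bsub>with_proj G\<^esub> v" if "u \<in> pverts G" "v \<in> pverts G" for u v
  proof (rule ccontr)
    assume nv: "\<not> u \<rightarrow>\<^sup>*\<^bsub>with_proj G\<^esub> v"
    define S where "S = {x. u \<rightarrow>\<^sup>*\<^bsub>with_proj G\<^esub> x}"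
    have "u \<in> S" using that by (simp add: S_def)
    then have "S \<inter> pverts G \<noteq> {}" "\<not> pverts G \<subseteq> S" using that nv by (auto simp: S_def)
    then obtain a b where "(a, b) \<in> parcs G" "a \<in> S" "b \<notin> S" using grown_cut[OF assms] by blast
    then show False using reachable_adj_trans[of u a b] by (simp add: S_def)
  qed
  then have conn: "Digraph_Component.connected (with_proj G)"
    using grown_root[OF assms] by (auto simp: connected_iff_reachable[OF G])
  have "\<not> 3 \<le> length p" if "cycle p" for p
  proof
    assume len: "3 \<le> length p"
    obtain u where u: "awalk u p u" "distinct (tl (pawalk_verts u p))"
      using \<open>cycle p\<close> by (auto simp: cycle_def)
    obtain e q where p: "p = e # q" using len by (cases p) auto
    define v where "v = snd e"
    have "fst e = u" and q: "pcas v q u" and arcs: "set (e # q) \<subseteq> parcs G"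
      using u(1) by (auto simp: p awalk_def v_def)
    then have uv: "(u, v) \<in> parcs G" by (auto simp: v_def)
    obtain S where S: "u \<in> S" "v \<notin> S"
      "\<And>a b. (a, b) \<in> parcs G \<Longrightarrow> a \<in> S \<Longrightarrow> b \<notin> S \<Longrightarrow> a = u \<and> b = v"
      using grown_bridge[OF assms uv] by blast
    obtain a b where ab: "(a, b) \<in> set q" "a \<notin> S" "b \<in> S"
      using pcas_cut[OF q, of "- S"] S by auto
    then have "(b, a) \<in> parcs G" using arcs pair_graphD(5)[OF G] by auto
    then have vu: "(v, u) \<in> set q" using S(3)[of b a] ab by auto
    obtain x q' where q': "q = (v, x) # q'" using q vu by (cases q) auto
    have dist: "v \<notin> set (pawalk_verts x q')" "distinct (pawalk_verts x q')" "pcas x q' u"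
      using u(2) q by (auto simp: p q' v_def)
    then have "(v, u) \<notin> set q'" using fst_in_pawalk_verts by fastforce
    then have "x = u" using vu q' by simp
    have "q' = []"
    proof (cases q')
      case (Cons f q'')
      then show ?thesis
        using dist \<open>x = u\<close> pcas_end_in_pawalk_verts[of "snd f" q'' u] by auto
    qed
    then show False using len p q' by simp
  qed
  then show ?thesis using G conn by (auto simp: simple_tree_def)
qed

lemma add_leaf_delete_vertices:
  assumes "pair_graph G" "W \<subseteq> pverts G" "(a, b) \<in> parcs G" "a \<in> W" "b \<notin> W"
    and "\<And>c. c \<in> W \<Longrightarrow> (b, c) \<in> parcs G \<Longrightarrow> c = a"
  shows "delete_vertices G (pverts G - insert b W) = add_leaf (delete_vertices G (pverts G - W)) a b"
proof -
  have "(x, y) \<in> parcs (delete_vertices G (pverts G - insert b W)) \<longleftrightarrow>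
      (x, y) \<in> parcs (add_leaf (delete_vertices G (pverts G - W)) a b)" for x y
  proof -
    note D = pair_graphD[OF assms(1)]
    have "(x, y) \<in> parcs (delete_vertices G (pverts G - insert b W)) \<longleftrightarrow>
        (x, y) \<in> parcs G \<and> x \<in> insert b W \<and> y \<in> insert b W"
      using D(2,3)[of x y] by auto
    also have "\<dots> \<longleftrightarrow> (x, y) \<in> parcs G \<and> x \<in> W \<and> y \<in> W \<or> (x, y) = (a, b) \<or> (x, y) = (b, a)"
      using assms(3-6) D(4)[of b b] D(5) by blast
    also have "\<dots> \<longleftrightarrow> (x, y) \<in> parcs (add_leaf (delete_vertices G (pverts G - W)) a b)"
      using D(2,3)[of x y] by auto
    finally show ?thesis .
  qed
  moreover have "pverts (delete_vertices G (pverts G - insert b W)) =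
      pverts (add_leaf (delete_vertices G (pverts G - W)) a b)"
    using assms pair_graphD(3)[OF assms(1)] by auto
  ultimately show ?thesis by (intro pair_pre_digraph_eqI)
qed

text \<open>
  Take a maximal vertex set \<open>W\<close> that induces a grown tree. If \<open>W\<close> misses a vertex, then by
  connectedness some outside vertex \<open>b\<close> is adjacent to some \<open>a\<close> in \<open>W\<close>; a second neighbor of \<open>b\<close> in
  \<open>W\<close> would close a cycle through a path in \<open>W\<close>, so \<open>b\<close> can be added as a leaf.
\<close>

lemma simple_tree_grown:
  assumes T: "simple_tree G" and r: "r \<in> pverts G"
  shows "grown r G"
proof -
  have G: "pair_graph G" using T by (simp add: simple_tree_def)
  interpret pair_graph G by (rule G)
  let ?on = "\<lambda>W. delete_vertices G (pverts G - W)"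
  define F where "F = {W. W \<subseteq> pverts G \<and> grown r (?on W)}"
  have "?on {r} = \<lparr>pverts = {r}, parcs = {}\<rparr>"
    using r pair_graphD[OF G] by (auto simp: delete_vertices_def)
  then have "{r} \<in> F" using r grown.single[of r] by (simp add: F_def)
  moreover have "finite F" using pair_graphD(1)[OF G] by (simp add: F_def)
  ultimately have "\<exists>W\<in>F. {r} \<subseteq> W \<and> (\<forall>W'\<in>F. W \<subseteq> W' \<longrightarrow> W = W')"
    by (intro finite_has_maximal2)
  then obtain W where W: "W \<in> F" "\<And>W'. W' \<in> F \<Longrightarrow> W \<subseteq> W' \<Longrightarrow> W = W'"
    by blast
  have WV: "W \<subseteq> pverts G" and gW: "grown r (?on W)" using W(1) by (auto simp: F_def)
  have rW: "r \<in> W" using grown_root[OF gW] by auto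
  have "W = pverts G"
  proof (rule ccontr)
    assume "W \<noteq> pverts G"
    then obtain t where t: "t \<in> pverts G" "t \<notin> W" using WV by blast
    have "r \<rightarrow>\<^sup>*\<^bsub>with_proj G\<^esub> t"
      using T connected_iff_reachable[OF G] r t by (auto simp: simple_tree_def)
    then obtain q where "awalk r q t" using reachable_awalk by blast
    then have "pcas r q t" "set q \<subseteq> parcs G" by (auto simp: awalk_def)
    then obtain a b where ab: "(a, b) \<in> parcs G" "a \<in> W" "b \<notin> W"
      using pcas_cut[of r q t W] rW t by auto
    have "c = a" if c: "c \<in> W" "(b, c) \<in> parcs G" for c
    proof (rule ccontr)
      assume "c \<noteq> a"
      interpret W: pair_graph "?on W" by (rule pair_graph_delete_vertices[OF G])
      have "a \<rightarrow>\<^sup>*\<^bsub>with_proj (?on W)\<^esub> c"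
        using grown_simple_tree[OF gW] connected_iff_reachable[OF W.pair_graph] ab c WV
        by (auto simp: simple_tree_def)
      then obtain p where p: "W.apath a p c" using W.reachable_apath by blast
      have pc: "pcas a p c" and ps: "set p \<subseteq> parcs (?on W)" and pd: "distinct (pawalk_verts a p)"
        using p by (auto simp: W.apath_def W.awalk_def)
      have pW: "set (pawalk_verts a p) \<subseteq> W"
        using ps ab(2) by (intro pawalk_verts_subset) (auto simp: delete_vertices_def
          dest: pair_graphD(2,3)[OF G])
      have ba: "(b, a) \<in> parcs G" "(c, b) \<in> parcs G" using ab c pair_graphD(5)[OF G] by blast+
      have pcas_snoc: "pcas u (q @ [(c, b)]) b" if "pcas u q c" for u q
        using that by (induction q arbitrary: u) auto
      have verts_snoc: "pawalk_verts u (q @ [(c, b)]) = pawalk_verts u q @ [b]" if "pcas u q c" for u q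
        using that by (induction q arbitrary: u) auto
      let ?p = "(b, a) # p @ [(c, b)]"
      have "awalk b ?p b"
        using ba ps pc pair_graphD(2)[OF G ba(1)] pcas_snoc[OF pc]
        by (auto simp: awalk_def delete_vertices_def)
      moreover have "distinct (tl (pawalk_verts b ?p))"
        using pd pW ab by (auto simp: verts_snoc[OF pc])
      ultimately have "cycle ?p" unfolding cycle_def by blast
      moreover have "p \<noteq> []" using pc \<open>c \<noteq> a\<close> by auto
      then have "3 \<le> length ?p" by (cases p) auto
      ultimately show False using T by (auto simp: simple_tree_def)
    qed
    then have "?on (insert b W) = add_leaf (?on W) a b"
      by (intro add_leaf_delete_vertices G WV ab) auto
    moreover have "grown r (add_leaf (?on W) a b)"
      using gW ab WV by (intro grown.leaf) auto
    ultimately have "insert b W \<in> F" using WV pair_graphD(3)[OF G ab(1)] by (simp add: F_def)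
    then show False using W(2)[of "insert b W"] ab by blast
  qed
  then have "?on W = G" by (simp add: delete_vertices_def)
  then show ?thesis using gW by simp
qed

lemma simple_tree_iff_grown: "simple_tree G \<longleftrightarrow> (\<exists>r. grown r G)"
proof
  assume T: "simple_tree G"
  then have "pverts G \<noteq> {}"
    using connected_iff_reachable[of G] unfolding simple_tree_def by blast
  then show "\<exists>r. grown r G" using simple_tree_grown[OF T] by blast
qed (auto intro: grown_simple_tree)

lemma simple_tree_add_leaf:
  assumes "simple_tree G" "p \<in> pverts G" "w \<notin> pverts G"
  shows "simple_tree (add_leaf G p w)"
proof -
  obtain r where "grown r G" using assms(1) by (auto simp: simple_tree_iff_grown)
  then show ?thesis by (intro grown_simple_tree grown.leaf assms)
qed

lemma simple_tree_cut:
  assumes "simple_tree G" "S \<inter> pverts G \<noteq> {}" "\<not> pverts G \<subseteq> S"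
  shows "\<exists>a b. (a, b) \<in> parcs G \<and> a \<in> S \<and> b \<notin> S"
proof -
  obtain r where "grown r G" using assms(1) by (auto simp: simple_tree_iff_grown)
  then show ?thesis by (rule grown_cut) (rule assms)+
qed

lemma simple_tree_bridge:
  assumes "simple_tree G" "(u, v) \<in> parcs G"
  obtains S where "S \<subseteq> pverts G" "u \<in> S" "v \<notin> S"
    "\<And>a b. (a, b) \<in> parcs G \<Longrightarrow> a \<in> S \<Longrightarrow> b \<notin> S \<Longrightarrow> a = u \<and> b = v"
proof -
  obtain r where "grown r G" using assms(1) by (auto simp: simple_tree_iff_grown)
  from grown_bridge[OF this assms(2)] show ?thesis using that by blast
qed

lemma simple_tree_depth_function:
  assumes "simple_tree G"
  shows "\<exists>h. depth_function G h"
proof -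
  obtain r where "grown r G" using assms by (auto simp: simple_tree_iff_grown)
  then show ?thesis by (rule grown_depth)
qed

text \<open>
  Growing the tree from the neighbor \<open>p\<close> of the leaf \<open>u\<close> ensures that \<open>u\<close> is added at some step; every
  other step can be done without \<open>u\<close>, because nothing is ever attached to \<open>u\<close>.
\<close>

lemma simple_tree_delete_leaf:
  assumes T: "simple_tree G" and u: "neighbors G u = {p}"
  shows "simple_tree (delete_vertices G {u})"
proof -
  have G: "pair_graph G" using T by (rule simple_tree_pair_graph)
  have "p \<in> neighbors G u" using u by simp
  then have "p \<in> pverts G" "u \<noteq> p" using pair_graphD[OF G] by auto
  then have "grown p G" using simple_tree_grown[OF T] by simp
  then have "grown p (delete_vertices G {u})" using u \<open>u \<noteq> p\<close>
  proof (induction arbitrary: rule: grown.induct)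
    case single
    then show ?case by (auto simp: set_eq_iff)
  next
    case (leaf G q w)
    have G: "pair_graph G" by (rule grown_pair_graph) fact
    have wG: "(a, b) \<in> parcs G \<Longrightarrow> a \<noteq> w \<and> b \<noteq> w" for a b
      using pair_graphD(2,3)[OF G] leaf.hyps by blast
    have nb: "(u, x) \<in> parcs (add_leaf G q w) \<longleftrightarrow> x = p" for x
      using leaf.prems(1) unfolding set_eq_iff neighbors_iff by simp
    show ?case
    proof (cases "u = w")
      case True
      then have "delete_vertices (add_leaf G q w) {u} = G"
        using leaf.hyps wG by (intro pair_pre_digraph_eqI) auto
      then show ?thesis using leaf.hyps by simp
    next
      case False
      have "u \<noteq> q"
      proof
        assume "u = q"
        then have "p = w" using nb[of w] by simp
        then show False using grown_root[OF leaf.hyps(1)] leaf.hyps by simp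
      qed
      then have "neighbors G u = {p}" using nb False unfolding set_eq_iff neighbors_iff by simp
      then have "grown p (delete_vertices G {u})" using leaf.IH leaf.prems by simp
      moreover have "delete_vertices (add_leaf G q w) {u} = add_leaf (delete_vertices G {u}) q w"
        using False \<open>u \<noteq> q\<close> by (intro pair_pre_digraph_eqI) auto
      ultimately show ?thesis using leaf.hyps \<open>u \<noteq> q\<close> by (auto intro: grown.leaf)
    qed
  qed
  then show ?thesis by (rule grown_simple_tree)
qed

text \<open>
  If an edge of \<open>H\<close> between vertices of \<open>T\<close> were not in \<open>T\<close>, the connected tree \<open>T\<close> would cross from one side of
  this bridge to the other without using it.
\<close>

lemma subtree_induced:
  assumes H: "simple_tree H" and T: "simple_tree T" and sub: "parcs T \<subseteq> parcs H"
    and ab: "a \<in> pverts T" "b \<in> pverts T" "(a, b) \<in> parcs H"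
  shows "(a, b) \<in> parcs T"
proof -
  obtain S where "S \<subseteq> pverts H" and S: "a \<in> S" "b \<notin> S"
    "\<And>c d. (c, d) \<in> parcs H \<Longrightarrow> c \<in> S \<Longrightarrow> d \<notin> S \<Longrightarrow> c = a \<and> d = b"
    by (rule simple_tree_bridge[OF H ab(3)]) blast
  obtain c d where "(c, d) \<in> parcs T" "c \<in> S" "d \<notin> S"
    using simple_tree_cut[OF T, of S] S ab by blast
  then show ?thesis using S(3)[of c d] sub by blast
qed

lemma subtree_outside_unique_neighbor:
  assumes H: "simple_tree H" and T: "simple_tree T" and sub: "parcs T \<subseteq> parcs H"
    and w: "w \<notin> pverts T" "(w, a) \<in> parcs H" "(w, b) \<in> parcs H"
    and ab: "a \<in> pverts T" "b \<in> pverts T"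
  shows "a = b"
proof (rule ccontr)
  assume "a \<noteq> b"
  obtain S where "S \<subseteq> pverts H" and S: "w \<in> S" "a \<notin> S"
    "\<And>c d. (c, d) \<in> parcs H \<Longrightarrow> c \<in> S \<Longrightarrow> d \<notin> S \<Longrightarrow> c = w \<and> d = a"
    by (rule simple_tree_bridge[OF H w(2)]) blast
  have "b \<in> S" using S(1) S(3)[of w b] w \<open>a \<noteq> b\<close> by blast
  then obtain c d where cd: "(c, d) \<in> parcs T" "c \<in> S" "d \<notin> S"
    using simple_tree_cut[OF T, of S] S ab by blast
  then have "c = w" using S(3)[of c d] sub by blast
  then show False using cd(1) w(1) pair_graphD(2)[OF simple_tree_pair_graph[OF T]] by blast
qed

section \<open>Maximal trees\<close>

lemma pendant_iff:
  assumes G: "pair_graph G"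
  shows "pendant G v \<longleftrightarrow> (\<exists>p. neighbors G v = {p})"
proof -
  have "out_arcs (with_proj G) v = Pair v ` neighbors G v"
    by (auto simp: out_arcs_def)
  then have "out_degree (with_proj G) v = card (neighbors G v)"
    by (simp add: out_degree_def card_image inj_on_def)
  moreover have "v \<in> pverts G" if "neighbors G v = {p}" for p
  proof -
    have "p \<in> neighbors G v" using that by simp
    then show ?thesis using pair_graphD(2)[OF G] by simp
  qed
  ultimately show ?thesis by (auto simp: pendant_def card_1_singleton_iff)
qed

lemma pre_pendant_iff:
  assumes G: "pair_graph G"
  shows "pre_pendant G v \<longleftrightarrow> (\<exists>u. neighbors G u = {v})"
proof
  assume "pre_pendant G v"
  then obtain u p where u: "neighbors G u = {p}" "(v, u) \<in> parcs G"
    by (auto simp: pre_pendant_def pendant_iff[OF G])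
  have "v = p" by (rule leaf_arc_unique[OF u(1) pair_graphD(5)[OF G u(2)]])
  then show "\<exists>u. neighbors G u = {v}" using u(1) by blast
next
  assume "\<exists>u. neighbors G u = {v}"
  then obtain u where u: "neighbors G u = {v}" by blast
  then have "v \<in> neighbors G u" by simp
  then have "(v, u) \<in> parcs G" "v \<in> pverts G" using pair_graphD[OF G] by auto
  then show "pre_pendant G v" using u by (auto simp: pre_pendant_def pendant_iff[OF G])
qed

lemma reducedD:
  "reduced G \<Longrightarrow> u \<in> pverts G \<Longrightarrow> v \<in> pverts G \<Longrightarrow> neighbors G u = neighbors G v \<Longrightarrow> u = v"
  unfolding reduced_def by blast

lemma subgraph_pair_graph_iff:
  assumes "pair_graph G" "pair_graph H"
  shows "subgraph (with_proj G) (with_proj H) \<longleftrightarrow>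
    pverts G \<subseteq> pverts H \<and> parcs G \<subseteq> parcs H"
proof -
  have "wf_digraph (with_proj G)" "wf_digraph (with_proj H)"
    using pair_graphD(2,3)[OF assms(1)] pair_graphD(2,3)[OF assms(2)]
    by (auto simp: wf_digraph_def)
  then show ?thesis by (auto simp: subgraph_def compatible_def)
qed

lemma subtree_rank_le:
  assumes "simple_tree T" "simple_tree H" "pverts T \<subseteq> pverts H" "parcs T \<subseteq> parcs H"
  shows "graph_rank T \<le> graph_rank H"
  using assms subtree_induced[OF assms(2,1,4)]
  by (intro graph_rank_induced_le simple_tree_pair_graph) auto

lemma simple_tree_neighbor_exists:
  assumes T: "simple_tree T" and v: "v \<in> pverts T" and u: "u \<in> pverts T" "u \<noteq> v"
  shows "\<exists>w. (v, w) \<in> parcs T"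
  using simple_tree_cut[OF T, of "{v}"] v u by auto

text \<open>
  Two common neighbors \<open>a\<close> and \<open>b\<close> of \<open>u\<close> and \<open>v\<close> would form a four-cycle. A deepest vertex of this
  cycle would have two neighbors on the level above it.
\<close>

lemma simple_tree_twins_pendant:
  assumes T: "simple_tree T" and uv: "u \<noteq> v" "neighbors T u = neighbors T v"
    and ab: "(u, a) \<in> parcs T" "(u, b) \<in> parcs T"
  shows "a = b"
proof (rule ccontr)
  assume "a \<noteq> b"
  note D = pair_graphD(5)[OF simple_tree_pair_graph[OF T]]
  obtain h where h: "depth_function T h" using simple_tree_depth_function[OF T] by blast
  have vab: "(v, a) \<in> parcs T" "(v, b) \<in> parcs T"
    using ab uv(2) by (simp_all flip: neighbors_iff)
  have "\<not> (h u = Suc (h a) \<and> h u = Suc (h b))" "\<not> (h v = Suc (h a) \<and> h v = Suc (h b))"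
    using depth_functionD(2)[OF h ab] depth_functionD(2)[OF h vab] \<open>a \<noteq> b\<close> by blast+
  moreover have "\<not> (h a = Suc (h u) \<and> h a = Suc (h v))" "\<not> (h b = Suc (h u) \<and> h b = Suc (h v))"
    using depth_functionD(2)[OF h D[OF ab(1)] D[OF vab(1)]]
      depth_functionD(2)[OF h D[OF ab(2)] D[OF vab(2)]] uv(1) by blast+
  ultimately show False
    using depth_functionD(1)[OF h ab(1)] depth_functionD(1)[OF h ab(2)]
      depth_functionD(1)[OF h vab(1)] depth_functionD(1)[OF h vab(2)] by linarith
qed

text \<open>
  Connectedness and the edge exclude isolated vertices, and by the previous lemma the only twins are
  leaves with the same neighbor.
\<close>

lemma simple_tree_reducedI:
  assumes T: "simple_tree T" and ab: "(a, b) \<in> parcs T"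
    and leaves: "\<And>u v p. neighbors T u = {p} \<Longrightarrow> neighbors T v = {p} \<Longrightarrow> u = v"
  shows "reduced T"
proof -
  note D = pair_graphD[OF simple_tree_pair_graph[OF T]]
  have nonempty: "\<exists>w. (v, w) \<in> parcs T" if v: "v \<in> pverts T" for v
    using simple_tree_neighbor_exists[OF T v, of a] simple_tree_neighbor_exists[OF T v, of b]
      D(2,3,4)[OF ab] by blast
  have "u = v" if uv: "u \<in> pverts T" "neighbors T u = neighbors T v" for u v
  proof (rule ccontr)
    assume "u \<noteq> v"
    obtain p where p: "(u, p) \<in> parcs T" using nonempty uv by blast
    have "neighbors T u = {p}"
      using p simple_tree_twins_pendant[OF T \<open>u \<noteq> v\<close> uv(2)] by (intro neighbors_eq_singletonI) blast+
    then show False using leaves[of u p v] uv \<open>u \<noteq> v\<close> by simp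
  qed
  moreover have "neighbors T v \<noteq> {}" if "v \<in> pverts T" for v
    using nonempty[OF that] by (simp add: set_eq_iff)
  ultimately show ?thesis unfolding reduced_def by blast
qed

text \<open>
  A criterion that tests only small extensions. A proper supertree \<open>H\<close> contains \<open>T\<close> with a new
  vertex \<open>w\<close> attached at some \<open>v\<close>. If \<open>v\<close> already has a leaf \<open>l\<close>, then \<open>H\<close> being reduced yields a vertex
  \<open>u\<close> adjacent to exactly one of \<open>l\<close> and \<open>w\<close>. If \<open>u\<close> is adjacent to \<open>w\<close>, the pendant pair \<open>u, w\<close>
  raises the rank by two in any case; so only \<open>u\<close> adjacent to \<open>l\<close> has to be covered by the
  hypothesis.
\<close>

lemma maximal_treeI:
  fixes T :: "'a::infinite pair_pre_digraph"
  assumes T: "simple_tree T" "reduced T"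
    and extend: "\<And>v. v \<in> pverts T \<Longrightarrow> (\<exists>x. null_vector T x \<and> x v \<noteq> 0) \<or>
      (\<exists>l. neighbors T l = {v} \<and> (\<forall>w u. w \<notin> pverts T \<longrightarrow> u \<notin> pverts T \<longrightarrow> u \<noteq> w \<longrightarrow>
         graph_rank T < graph_rank (add_leaf (add_leaf T v w) l u)))"
  shows "maximal_tree T"
  unfolding maximal_tree_def
proof (intro conjI T notI, elim exE conjE)
  fix H :: "'a pair_pre_digraph"
  assume H: "simple_tree H" "reduced H" and rank: "graph_rank H = graph_rank T"
    and "subgraph (with_proj T) (with_proj H)" and ne: "T \<noteq> H"
  then have sub: "pverts T \<subseteq> pverts H" "parcs T \<subseteq> parcs H"
    using subgraph_pair_graph_iff[of T H] simple_tree_pair_graph T by blast+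
  note DT = pair_graphD[OF simple_tree_pair_graph[OF T(1)]]
  note DH = pair_graphD[OF simple_tree_pair_graph[OF H(1)]]
  have no: "\<not> graph_rank T < graph_rank K"
    if "simple_tree K" "pverts K \<subseteq> pverts H" "parcs K \<subseteq> parcs H" for K
    using subtree_rank_le[OF that(1) H(1) that(2,3)] rank by simp
  have "\<not> pverts H \<subseteq> pverts T"
  proof
    assume "pverts H \<subseteq> pverts T"
    then have eq: "pverts T = pverts H" using sub by blast
    moreover have "(a, b) \<in> parcs T \<longleftrightarrow> (a, b) \<in> parcs H" for a b
      using sub subtree_induced[OF H(1) T(1) sub(2), of a b] DH(2,3) eq by blast
    ultimately show False using ne pair_pre_digraph_eqI by blast
  qed
  moreover have "pverts T \<inter> pverts H \<noteq> {}"
    using T(1) sub grown_root by (fastforce simp: simple_tree_iff_grown)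
  ultimately obtain v w where vw: "(v, w) \<in> parcs H" "v \<in> pverts T" "w \<notin> pverts T"
    using simple_tree_cut[OF H(1), of "pverts T"] by blast
  have wv: "(w, v) \<in> parcs H" using DH(5)[OF vw(1)] .
  let ?T1 = "add_leaf T v w"
  have T1: "simple_tree ?T1" by (rule simple_tree_add_leaf[OF T(1) vw(2,3)])
  have T1H: "pverts ?T1 \<subseteq> pverts H" "parcs ?T1 \<subseteq> parcs H"
    using sub vw wv DH(3)[OF vw(1)] by (auto simp: add_leaf_def)
  have w_only: "z = v" if "(w, z) \<in> parcs H" "z \<in> pverts T" for z
    using subtree_outside_unique_neighbor[OF H(1) T(1) sub(2) vw(3) that(1) wv that(2) vw(2)] .
  from extend[OF vw(2)] show False
  proof (elim disjE exE conjE)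
    fix x assume "null_vector T x" "x v \<noteq> 0"
    then have "graph_rank T < graph_rank ?T1"
      by (rule graph_rank_add_leaf_greater[OF simple_tree_pair_graph[OF T(1)] vw(2,3)])
    then show False using no[OF T1 T1H] by simp
  next
    fix l assume l: "neighbors T l = {v}" and big: "\<forall>w u. w \<notin> pverts T \<longrightarrow> u \<notin> pverts T \<longrightarrow>
      u \<noteq> w \<longrightarrow> graph_rank T < graph_rank (add_leaf (add_leaf T v w) l u)"
    have lv: "(l, v) \<in> parcs T" "l \<in> pverts T" "l \<noteq> v"
      using leaf_arc[OF l] DT by blast+
    have "l \<in> pverts H" "w \<in> pverts H" "l \<noteq> w" using lv(2) vw sub(1) DH(3)[OF vw(1)] by auto
    then have "neighbors H l \<noteq> neighbors H w" using H(2) by (simp add: reduced_def)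
    then obtain u where u: "((l, u) \<in> parcs H) \<noteq> ((w, u) \<in> parcs H)"
      by (auto simp: set_eq_iff)
    have "u \<noteq> v" using u lv wv sub by blast
    have nu: "u \<in> pverts T \<Longrightarrow> (l, u) \<notin> parcs H"
      using subtree_induced[OF H(1) T(1) sub(2) lv(2), of u] leaf_arc_unique[OF l] \<open>u \<noteq> v\<close> by blast
    have uT: "u \<notin> pverts T" using u nu w_only \<open>u \<noteq> v\<close> by blast
    show False
    proof (cases "(w, u) \<in> parcs H")
      case True
      have "u \<noteq> w" using True DH(4) by blast
      let ?T2 = "add_leaf ?T1 w u"
      have T2: "simple_tree ?T2"
        by (rule simple_tree_add_leaf[OF T1]) (use uT \<open>u \<noteq> w\<close> in auto)
      have "pverts ?T2 \<subseteq> pverts H" "parcs ?T2 \<subseteq> parcs H"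
        using T1H True DH(3,5)[OF True] by (auto simp: add_leaf_def)
      then have "\<not> graph_rank T < graph_rank ?T2" using no T2 by blast
      moreover have "neighbors ?T2 u = {w}"
        using uT \<open>u \<noteq> w\<close> \<open>u \<noteq> v\<close> DT(2)[of u] by (intro neighbors_eq_singletonI) auto
      then have "graph_rank ?T2 = graph_rank (delete_vertices ?T2 {u, w}) + 2"
        by (rule graph_rank_delete_pendant_pair[OF simple_tree_pair_graph[OF T2]])
      moreover have "delete_vertices ?T2 {u, w} = T"
        using uT vw DT(2,3) by (intro pair_pre_digraph_eqI) auto
      ultimately show False by simp
    next
      case False
      then have lu: "(l, u) \<in> parcs H" using u by blast
      have "u \<noteq> w"
      proof
        assume "u = w"
        then have "(w, l) \<in> parcs H" using DH(5)[OF lu] by simp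
        then show False using w_only lv by blast
      qed
      let ?T2 = "add_leaf ?T1 l u"
      have T2: "simple_tree ?T2"
        by (rule simple_tree_add_leaf[OF T1]) (use uT lv \<open>u \<noteq> w\<close> in auto)
      have "pverts ?T2 \<subseteq> pverts H" "parcs ?T2 \<subseteq> parcs H"
        using T1H lu DH(3,5)[OF lu] by (auto simp: add_leaf_def)
      then have "\<not> graph_rank T < graph_rank ?T2" using no T2 by blast
      then show False using big vw uT \<open>u \<noteq> w\<close> by blast
    qed
  qed
qed

text \<open>
  The shape of the maximal trees of rank at least four; \<open>A\<close> turns out to be the set of pre-pendant
  vertices. The remaining vertices are independent and include all pendant ones.
\<close>

definition core_tree :: "'a pair_pre_digraph \<Rightarrow> 'a set \<Rightarrow> bool" where
  "core_tree T A \<longleftrightarrow> simple_tree T \<and> A \<subseteq> pverts T \<and> A \<noteq> {} \<and>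
     (\<forall>a b. (a, b) \<in> parcs T \<longrightarrow> a \<in> A \<or> b \<in> A) \<and>
     (\<forall>a\<in>A. \<exists>!l. neighbors T l = {a}) \<and>
     (\<forall>a\<in>A. \<exists>b c. b \<noteq> c \<and> b \<notin> A \<and> c \<notin> A \<and> (a, b) \<in> parcs T \<and> (a, c) \<in> parcs T)"

lemma core_treeD:
  assumes "core_tree T A"
  shows "simple_tree T" "pair_graph T" "A \<subseteq> pverts T" "A \<noteq> {}"
    and "(a, b) \<in> parcs T \<Longrightarrow> a \<notin> A \<Longrightarrow> b \<in> A"
    and "a \<in> A \<Longrightarrow> \<exists>l. neighbors T l = {a}"
    and "a \<in> A \<Longrightarrow> neighbors T l = {a} \<Longrightarrow> neighbors T m = {a} \<Longrightarrow> l = m"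
    and "a \<in> A \<Longrightarrow> \<exists>b c. b \<noteq> c \<and> b \<notin> A \<and> c \<notin> A \<and> (a, b) \<in> parcs T \<and> (a, c) \<in> parcs T"
  using assms simple_tree_pair_graph unfolding core_tree_def by blast+

lemma core_tree_leaf_outside:
  assumes T: "core_tree T A" and l: "neighbors T l = {a}"
  shows "l \<notin> A" "a \<in> A"
proof -
  show "l \<notin> A" using core_treeD(8)[OF T, of l] leaf_arc_unique[OF l] by blast
  then show "a \<in> A" using core_treeD(5)[OF T leaf_arc[OF l]] by blast
qed

lemma core_tree_pre_pendant_iff:
  assumes T: "core_tree T A"
  shows "pre_pendant T v \<longleftrightarrow> v \<in> A"
  using core_tree_leaf_outside(2)[OF T] core_treeD(6)[OF T]
  unfolding pre_pendant_iff[OF core_treeD(2)[OF T]] by blast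

text \<open>
  Only one of the two neighbors of \<open>a\<close> outside \<open>A\<close> can be its leaf.
\<close>

lemma core_tree_nonleaf_neighbor:
  assumes T: "core_tree T A" and a: "a \<in> A"
  shows "\<exists>d e. (a, d) \<in> parcs T \<and> d \<notin> A \<and> (d, e) \<in> parcs T \<and> e \<noteq> a \<and> e \<in> A"
proof -
  note D = pair_graphD[OF core_treeD(2)[OF T]]
  obtain b c where bc: "b \<noteq> c" "b \<notin> A" "c \<notin> A" "(a, b) \<in> parcs T" "(a, c) \<in> parcs T"
    using core_treeD(8)[OF T a] by blast
  then have "\<not> (neighbors T b = {a} \<and> neighbors T c = {a})" using core_treeD(7)[OF T a] by blast
  then obtain d where d: "d \<notin> A" "(a, d) \<in> parcs T" "neighbors T d \<noteq> {a}" using bc by blast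
  then obtain e where "(d, e) \<in> parcs T" "e \<noteq> a"
    using neighbors_eq_singletonI[OF D(5)[OF d(2)]] by blast
  then show ?thesis using d core_treeD(5)[OF T] by blast
qed

lemma core_tree_rank:
  assumes T: "core_tree T A"
  shows "graph_rank T = 2 * card A"
proof (rule graph_rank_private_leaves[OF core_treeD(2,3)[OF T]])
  show "a \<in> A \<or> b \<in> A" if "(a, b) \<in> parcs T" for a b using core_treeD(5)[OF T that] by blast
  show "\<exists>l. l \<notin> A \<and> neighbors T l = {a}" if "a \<in> A" for a
    using core_treeD(6)[OF T that] core_tree_leaf_outside(1)[OF T] by blast
qed

text \<open>
  The vector is one at \<open>d\<close> and minus one at the leaf of each neighbor of \<open>d\<close>. It vanishes on \<open>A\<close>, so only
  equations at vertices \<open>i\<close> of \<open>A\<close> matter, and there the leaf of \<open>i\<close> cancels \<open>d\<close>.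
\<close>

lemma core_tree_null_vector_nonleaf:
  assumes T: "core_tree T A" and d: "d \<notin> A"
  shows "null_vector T
    (\<lambda>k. of_bool (k = d) - of_bool (\<exists>a. neighbors T k = {a} \<and> (d, a) \<in> parcs T))"
    (is "null_vector T ?x")
  unfolding null_vector_def
proof
  note D = pair_graphD[OF core_treeD(2)[OF T]]
  fix i assume i: "i \<in> pverts T"
  show "neighbor_sum T ?x i = 0"
  proof (cases "i \<in> A")
    case False
    have "?x k = 0" if k: "(i, k) \<in> parcs T" for k
    proof -
      have "k \<in> A" using core_treeD(5)[OF T k] False by blast
      then have "k \<noteq> d" "\<nexists>a. neighbors T k = {a}" using d core_tree_leaf_outside(1)[OF T] by blast+
      then show ?thesis by simp
    qed
    then show ?thesis by (simp add: neighbor_sum_def)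
  next
    case True
    then obtain l where l: "neighbors T l = {i}" using core_treeD(6)[OF T] by blast
    have il: "(i, l) \<in> parcs T" using leaf_arc[OF l] D(5) by blast
    have leaf: "(\<exists>a. neighbors T k = {a} \<and> (d, a) \<in> parcs T) \<longleftrightarrow> k = l \<and> (d, i) \<in> parcs T"
      if k: "(i, k) \<in> parcs T" for k
    proof
      assume "\<exists>a. neighbors T k = {a} \<and> (d, a) \<in> parcs T"
      then obtain a where a: "neighbors T k = {a}" "(d, a) \<in> parcs T" by blast
      have "i = a" using leaf_arc_unique[OF a(1)] D(5)[OF k] by blast
      then show "k = l \<and> (d, i) \<in> parcs T" using core_treeD(7)[OF T True] a l by blast
    next
      assume "k = l \<and> (d, i) \<in> parcs T"
      then show "\<exists>a. neighbors T k = {a} \<and> (d, a) \<in> parcs T" using l by blast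
    qed
    have "neighbor_sum T ?x i = neighbor_sum T
      (\<lambda>k. 1 * of_bool (k = d) + (- of_bool ((d, i) \<in> parcs T)) * of_bool (k = l)) i"
      unfolding neighbor_sum_def by (intro sum.cong) (auto simp: leaf)
    also have "\<dots> = of_bool ((i, d) \<in> parcs T) - of_bool ((d, i) \<in> parcs T)"
      unfolding neighbor_sum_linear neighbor_sum_indicator[OF core_treeD(2)[OF T]] using il by simp
    also have "\<dots> = 0" using D(5)[of i d] D(5)[of d i] by auto
    finally show ?thesis .
  qed
qed

text \<open>
  For a vertex that is no leaf, take the vector belonging to it; for the leaf of \<open>a\<close>, take the one
  belonging to a neighbor of \<open>a\<close> outside \<open>A\<close> other than the leaf.
\<close>

lemma core_tree_null_vector:
  assumes T: "core_tree T A" and v: "v \<in> pverts T" "v \<notin> A"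
  shows "\<exists>x. null_vector T x \<and> x v \<noteq> 0"
proof (cases "\<exists>a. neighbors T v = {a}")
  case False
  then show ?thesis using core_tree_null_vector_nonleaf[OF T v(2)] by (intro exI conjI) auto
next
  case True
  then obtain a where a: "neighbors T v = {a}" by blast
  note D = pair_graphD[OF core_treeD(2)[OF T]]
  obtain d e where d: "(a, d) \<in> parcs T" "d \<notin> A" "(d, e) \<in> parcs T" "e \<noteq> a"
    using core_tree_nonleaf_neighbor[OF T core_tree_leaf_outside(2)[OF T a]] by blast
  have "v \<noteq> d" using leaf_arc_unique[OF a, of e] d by blast
  moreover have "\<exists>b. neighbors T v = {b} \<and> (d, b) \<in> parcs T" using a D(5)[OF d(1)] by blast
  ultimately show ?thesis using core_tree_null_vector_nonleaf[OF T d(2)] by (intro exI conjI) auto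
qed

lemma core_tree_reduced:
  assumes T: "core_tree T A"
  shows "reduced T"
proof -
  obtain a where "a \<in> A" using core_treeD(4)[OF T] by blast
  then obtain b where "(a, b) \<in> parcs T" using core_treeD(8)[OF T] by blast
  then show ?thesis
    using core_treeD(1,7)[OF T] core_tree_leaf_outside(2)[OF T]
    by (intro simple_tree_reducedI) blast+
qed

text \<open>
  Vertices outside \<open>A\<close> satisfy the first alternative of the criterion. A vertex \<open>v\<close> of \<open>A\<close> satisfies the
  second one, since already adding \<open>u\<close> at its leaf \<open>l\<close>, which lies outside \<open>A\<close>, raises the rank.
\<close>

lemma core_tree_maximal:
  assumes T: "core_tree T A"
  shows "maximal_tree T"
proof (rule maximal_treeI[OF core_treeD(1)[OF T] core_tree_reduced[OF T]])
  note G = core_treeD(1,2)[OF T]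
  fix v assume v: "v \<in> pverts T"
  show "(\<exists>x. null_vector T x \<and> x v \<noteq> 0) \<or>
      (\<exists>l. neighbors T l = {v} \<and> (\<forall>w u. w \<notin> pverts T \<longrightarrow> u \<notin> pverts T \<longrightarrow> u \<noteq> w \<longrightarrow>
         graph_rank T < graph_rank (add_leaf (add_leaf T v w) l u)))"
  proof (cases "v \<in> A")
    case False
    then show ?thesis using core_tree_null_vector[OF T v] by blast
  next
    case True
    then obtain l where l: "neighbors T l = {v}" using core_treeD(6)[OF T] by blast
    have lV: "l \<in> pverts T" using leaf_arc[OF l] pair_graphD(2)[OF G(2)] by blast
    obtain x where x: "null_vector T x" "x l \<noteq> 0"
      using core_tree_null_vector[OF T lV core_tree_leaf_outside(1)[OF T l]] by blast
    have "graph_rank T < graph_rank (add_leaf (add_leaf T v w) l u)"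
      if wu: "w \<notin> pverts T" "u \<notin> pverts T" "u \<noteq> w" for w u
    proof -
      have "graph_rank T < graph_rank (add_leaf T l u)"
        by (rule graph_rank_add_leaf_greater[OF G(2) lV wu(2) x])
      also have "\<dots> \<le> graph_rank (add_leaf (add_leaf T v w) l u)"
        using G(1) lV v wu
        by (intro subtree_rank_le simple_tree_add_leaf) (auto simp: add_leaf_def)
      finally show ?thesis .
    qed
    then show ?thesis using l by blast
  qed
qed

text \<open>
  The single edge is not of the above shape. Here both vertices fall under the second alternative of
  the criterion: one new vertex at each end gives a path on four vertices, of rank four.
\<close>

lemma edge_maximal_tree:
  fixes a b :: "'a::infinite"
  assumes "a \<noteq> b"
  defines "K \<equiv> \<lparr>pverts = {a, b}, parcs = {(a, b), (b, a)}\<rparr>"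
  shows "maximal_tree K" "graph_rank K = 2"
proof -
  have K: "K = add_leaf \<lparr>pverts = {a}, parcs = {}\<rparr> a b" by (auto simp: K_def add_leaf_def)
  have T: "simple_tree K"
    unfolding K using assms(1) by (intro grown_simple_tree[OF grown.leaf[OF grown.single[of a]]]) auto
  note G = simple_tree_pair_graph[OF T]
  have nb: "neighbors K a = {b}" "neighbors K b = {a}" using assms(1) by (auto simp: K_def)
  have "graph_rank K = 2 * card {a}"
    using nb assms(1) by (intro graph_rank_private_leaves[OF G]) (auto simp: K_def)
  then show rank: "graph_rank K = 2" by simp
  have big: "graph_rank K < graph_rank (add_leaf (add_leaf K v w) l u)"
    if vl: "{v, l} = {a, b}" "v \<noteq> l" and wu: "w \<notin> pverts K" "u \<notin> pverts K" "u \<noteq> w" for v l w u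
  proof -
    let ?T = "add_leaf (add_leaf K v w) l u"
    have Kv: "pverts K = {v, l}" "parcs K = {(v, l), (l, v)}" using vl by (auto simp: K_def doubleton_eq_iff)
    have ne: "w \<noteq> v" "w \<noteq> l" "u \<noteq> v" "u \<noteq> l" using wu Kv by auto
    have "simple_tree (add_leaf K v w)" by (rule simple_tree_add_leaf[OF T]) (use Kv wu in auto)
    then have "simple_tree ?T" by (rule simple_tree_add_leaf) (use Kv wu in auto)
    moreover have "neighbors ?T w = {v}" "neighbors ?T u = {l}"
      using ne wu(3) by (auto simp: Kv(2) intro!: neighbors_eq_singletonI)
    ultimately have "graph_rank ?T = 2 * card {v, l}"
      using ne by (intro graph_rank_private_leaves simple_tree_pair_graph) (auto simp: Kv)
    then show ?thesis using rank vl(2) by simp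
  qed
  have "reduced K" using nb assms(1) by (auto simp: reduced_def K_def)
  then show "maximal_tree K"
  proof (rule maximal_treeI[OF T])
    fix v assume "v \<in> pverts K"
    then obtain l where l: "{v, l} = {a, b}" "v \<noteq> l" "neighbors K l = {v}"
      using nb assms(1) by (auto simp: K_def)
    then show "(\<exists>x. null_vector K x \<and> x v \<noteq> 0) \<or>
      (\<exists>l. neighbors K l = {v} \<and> (\<forall>w u. w \<notin> pverts K \<longrightarrow> u \<notin> pverts K \<longrightarrow> u \<noteq> w \<longrightarrow>
         graph_rank K < graph_rank (add_leaf (add_leaf K v w) l u)))"
      using big[OF l(1,2)] by blast
  qed
qed

text \<open>
  In a bipartite graph the equations at one color class involve only values on the other class, so
  a vector can be cut down to one class.
\<close>

lemma neighbor_sum_parity_restrict: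
  assumes h: "depth_function G h"
  shows "neighbor_sum G (\<lambda>k. if even (h k + c) then x k else 0) i =
    (if odd (h i + c) then neighbor_sum G x i else 0)"
proof -
  have "even (h k + c) \<longleftrightarrow> odd (h i + c)" if "(i, k) \<in> parcs G" for k
    using depth_functionD(1)[OF h that] by auto
  then have "neighbor_sum G (\<lambda>k. if even (h k + c) then x k else 0) i =
      (\<Sum>k\<in>neighbors G i. if odd (h i + c) then x k else 0)"
    unfolding neighbor_sum_def by (intro sum.cong) auto
  then show ?thesis by (simp add: neighbor_sum_def)
qed

text \<open>
  Otherwise there is a preimage \<open>y\<close> of the indicator of \<open>v\<close>. Restricting it to the color class
  opposite to \<open>v\<close> makes it vanish at \<open>v\<close>, so a new leaf at \<open>v\<close> keeps the rank. As \<open>v\<close>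
  had no leaf, the larger tree is still reduced, against maximality.
\<close>

lemma maximal_tree_null_vector:
  fixes T :: "'a::infinite pair_pre_digraph"
  assumes max: "maximal_tree T" and v: "v \<in> pverts T" and noleaf: "\<nexists>l. neighbors T l = {v}"
  shows "\<exists>x. null_vector T x \<and> x v \<noteq> 0"
proof (rule ccontr)
  assume none: "\<nexists>x. null_vector T x \<and> x v \<noteq> 0"
  have T: "simple_tree T" "reduced T" using max by (simp_all add: maximal_tree_def)
  have G: "pair_graph T" by (rule simple_tree_pair_graph[OF T(1)])
  note D = pair_graphD[OF G]
  obtain h where h: "depth_function T h" using simple_tree_depth_function[OF T(1)] by blast
  obtain y where y: "\<forall>i\<in>pverts T. neighbor_sum T y i = of_bool (i = v)"
    using null_vector_or_column_equation[OF G v] none by blast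
  define z where "z k = (if even (h k + (h v + 1)) then y k else 0)" for k
  have "neighbor_sum T z i = of_bool (i = v)" if "i \<in> pverts T" for i
    unfolding z_def neighbor_sum_parity_restrict[OF h] using y that by auto
  moreover have "z v = 0" by (simp add: z_def)
  moreover obtain w where w: "w \<notin> pverts T"
    using ex_new_if_finite[OF infinite_UNIV D(1)] by blast
  ultimately have rank: "graph_rank (add_leaf T v w) = graph_rank T"
    by (intro graph_rank_add_leaf_same[OF G v])
  let ?H = "add_leaf T v w"
  have H: "simple_tree ?H" by (rule simple_tree_add_leaf[OF T(1) v w])
  have Tleaf: "neighbors T u = {p}" if u: "neighbors ?H u = {p}" "u \<noteq> w" "u \<noteq> v" for u p
  proof (rule neighbors_eq_singletonI)
    show "(u, p) \<in> parcs T" using leaf_arc[OF u(1)] u(2,3) by simp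
    show "q = p" if "(u, q) \<in> parcs T" for q using leaf_arc_unique[OF u(1), of q] that by simp
  qed
  have vleaf: "p = w" if "neighbors ?H v = {p}" for p
    using leaf_arc_unique[OF that, of w] by simp
  have wleaf: "p = v" if "neighbors ?H w = {p}" for p
    using leaf_arc_unique[OF that, of v] by simp
  have unique: "u = v \<and> p = w \<or> u = w \<and> p = v \<or> neighbors T u = {p} \<and> p \<noteq> w \<and> p \<noteq> v"
    if u: "neighbors ?H u = {p}" for u p
  proof (cases "u = w \<or> u = v")
    case False
    then have n: "neighbors T u = {p}" using Tleaf u by blast
    then have "p \<noteq> v" using noleaf by blast
    then show ?thesis using n leaf_arc[OF n] D(3) w by blast
  qed (use u vleaf wleaf in blast)
  have "reduced ?H"
  proof (rule simple_tree_reducedI[OF H])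
    show "(v, w) \<in> parcs ?H" by simp
    fix u u' p assume "neighbors ?H u = {p}" "neighbors ?H u' = {p}"
    from unique[OF this(1)] unique[OF this(2)]
    consider "u = u'" | "neighbors T u = {p}" "neighbors T u' = {p}" | "v = w" by blast
    then show "u = u'"
    proof cases
      case 2
      then have "u \<in> pverts T" "u' \<in> pverts T" by (auto intro: leaf_in_pverts[OF G])
      then show ?thesis using 2 by (intro reducedD[OF T(2)]) simp_all
    qed (use v w in auto)
  qed
  moreover have "subgraph (with_proj T) (with_proj ?H)"
    using subgraph_pair_graph_iff[OF G simple_tree_pair_graph[OF H]] by (auto simp: add_leaf_def)
  moreover have "T \<noteq> ?H" using w by (metis add_leaf_simps(1) insertI1)
  ultimately show False using max H rank unfolding maximal_tree_def by blast
qed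

lemma maximal_tree_core:
  fixes T :: "'a::infinite pair_pre_digraph"
  assumes max: "maximal_tree T" and rank: "graph_rank T \<ge> 4"
  shows "core_tree T {v. pre_pendant T v}"
proof -
  have T: "simple_tree T" "reduced T" using max by (simp_all add: maximal_tree_def)
  have G: "pair_graph T" by (rule simple_tree_pair_graph[OF T(1)])
  note D = pair_graphD[OF G]
  define A where "A = {v. pre_pendant T v}"
  have A: "a \<in> A \<longleftrightarrow> (\<exists>l. neighbors T l = {a})" for a
    by (simp add: A_def pre_pendant_iff[OF G])
  have AV: "A \<subseteq> pverts T" by (auto simp: A_def pre_pendant_def)
  have leaf_unique: "l = m" if "neighbors T l = {a}" "neighbors T m = {a}" for l m a
  proof -
    have "l \<in> pverts T" "m \<in> pverts T" by (rule leaf_in_pverts[OF G], rule that)+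
    then show ?thesis using that by (intro reducedD[OF T(2)]) simp_all
  qed
  \<comment> \<open>A leaf adjacent to a leaf would make the tree a single edge, of rank two.\<close>
  have leaf_outside: "l \<notin> A" if l: "neighbors T l = {a}" for l a
  proof
    assume "l \<in> A"
    then obtain m where m: "neighbors T m = {l}" using A by blast
    have "m = a" using leaf_arc_unique[OF l] D(5)[OF leaf_arc[OF m]] by blast
    then have a: "neighbors T a = {l}" using m by simp
    have la: "l \<in> pverts T" "a \<in> pverts T" "a \<noteq> l" using leaf_arc[OF l] D by blast+
    have "pverts T \<subseteq> {l, a}"
    proof (rule ccontr)
      assume "\<not> pverts T \<subseteq> {l, a}"
      then obtain c d where "(c, d) \<in> parcs T" "c \<in> {l, a}" "d \<notin> {l, a}"
        using simple_tree_cut[OF T(1), of "{l, a}"] la by blast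
      then show False using leaf_arc_unique[OF a] leaf_arc_unique[OF l] by blast
    qed
    then have "c = a \<or> d = a" if "(c, d) \<in> parcs T" for c d using D(2,3,4)[OF that] by blast
    then have "graph_rank T = 2 * card {a}"
      using l la by (intro graph_rank_private_leaves[OF G]) (auto intro!: exI[of _ l])
    then show False using rank by simp
  qed
  have null: "\<exists>x. null_vector T x \<and> x v \<noteq> 0" if "v \<in> pverts T" "v \<notin> A" for v
    using maximal_tree_null_vector[OF max that(1)] that(2) A by blast
  have null_A: "x a = 0" if x: "null_vector T x" and a: "a \<in> A" for x a
  proof -
    obtain l where l: "neighbors T l = {a}" using a A by blast
    then have "l \<in> pverts T" by (rule leaf_in_pverts[OF G])
    then have "neighbor_sum T x l = 0" using x by (simp add: null_vector_def)
    then show ?thesis by (simp add: neighbor_sum_def l)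
  qed
  have indep: "a \<in> A \<or> b \<in> A" if ab: "(a, b) \<in> parcs T" for a b
  proof (rule ccontr)
    assume nA: "\<not> (a \<in> A \<or> b \<in> A)"
    obtain h where h: "depth_function T h" using simple_tree_depth_function[OF T(1)] by blast
    obtain x y where xy: "null_vector T x" "x a \<noteq> 0" "null_vector T y" "y b \<noteq> 0"
      using null nA D(2,3)[OF ab] by blast
    \<comment> \<open>Restricting to the color classes of \<open>a\<close> and \<open>b\<close> makes the two null vectors vanish at the other end.\<close>
    define x' where "x' k = (if even (h k + h a) then x k else 0)" for k
    define y' where "y' k = (if even (h k + h b) then y k else 0)" for k
    have null': "null_vector T x'" "null_vector T y'"
      using xy unfolding null_vector_def x'_def y'_def neighbor_sum_parity_restrict[OF h] by auto
    have vals: "x' a \<noteq> 0" "y' b \<noteq> 0" "x' b = 0" "y' a = 0"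
      using xy depth_functionD(1)[OF h ab] by (auto simp: x'_def y'_def)
    obtain S where SV: "S \<subseteq> pverts T" and S: "a \<in> S" "b \<notin> S"
      "\<And>c d. (c, d) \<in> parcs T \<Longrightarrow> c \<in> S \<Longrightarrow> d \<notin> S \<Longrightarrow> c = a \<and> d = b"
      by (rule simple_tree_bridge[OF T(1) ab]) blast
    have zero: "(\<Sum>i\<in>S. f i * neighbor_sum T g i) = 0" if "null_vector T g" for f g
      using that SV by (intro sum.neutral) (auto simp: null_vector_def)
    have cut: "{(i, j) \<in> parcs T. i \<in> S \<and> j \<notin> S} = {(a, b)}" using S ab by blast
    have "finite S" using SV D(1) finite_subset by blast
    from neighbor_sum_Green[OF G this, of x' y'] have "x' a * y' b = 0"
      unfolding cut zero[OF null'(1)] zero[OF null'(2)] using vals by simp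
    then show False using vals by simp
  qed
  have "graph_rank T = 2 * card A"
    using A leaf_outside by (intro graph_rank_private_leaves[OF G AV] indep) blast+
  then have "A \<noteq> {}" using rank by auto
  \<comment> \<open>With no second neighbor outside \<open>A\<close>, the equation at \<open>a\<close> would say that every null vector vanishes
    at the leaf of \<open>a\<close>.\<close>
  have two: "\<exists>b c. b \<noteq> c \<and> b \<notin> A \<and> c \<notin> A \<and> (a, b) \<in> parcs T \<and> (a, c) \<in> parcs T"
    if a: "a \<in> A" for a
  proof -
    obtain l where l: "neighbors T l = {a}" using a A by blast
    have al: "(a, l) \<in> parcs T" "l \<in> pverts T" using leaf_arc[OF l] D by blast+
    obtain x where x: "null_vector T x" "x l \<noteq> 0"
      using null[OF al(2) leaf_outside[OF l]] by blast
    have "\<exists>c. c \<noteq> l \<and> c \<notin> A \<and> (a, c) \<in> parcs T"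
    proof (rule ccontr)
      assume "\<not> ?thesis"
      then have "x c = 0" if "c \<in> neighbors T a - {l}" for c
        using null_A[OF x(1)] that by auto
      then have "neighbor_sum T x a = (\<Sum>c\<in>{l}. x c)"
        unfolding neighbor_sum_def using al finite_neighbors[OF G]
        by (intro sum.mono_neutral_right) auto
      then show False using x AV a by (auto simp: null_vector_def)
    qed
    then show ?thesis using al leaf_outside[OF l] by blast
  qed
  have "\<exists>!l. neighbors T l = {a}" if a: "a \<in> A" for a
  proof -
    obtain l where l: "neighbors T l = {a}" using a A by blast
    show ?thesis by (rule ex1I[of _ l], rule l) (rule leaf_unique[OF _ l])
  qed
  then show ?thesis
    unfolding A_def[symmetric] core_tree_def
    by (intro conjI ballI allI impI T(1) AV \<open>A \<noteq> {}\<close> indep two)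
qed

section \<open>Peeling a core tree\<close>

text \<open>
  For explicit lists this form can be evaluated by simplification.
\<close>

lemma path_graph_consecutive:
  "path_graph n P \<longleftrightarrow> (\<exists>vs. distinct vs \<and> length vs = n \<and> pverts P = set vs \<and>
     parcs P = set (zip vs (tl vs)) \<union> set (zip (tl vs) vs))"
proof -
  have "{(vs ! i, vs ! j) | i j. i < n \<and> j < n \<and> (j = Suc i \<or> i = Suc j)} =
      set (zip vs (tl vs)) \<union> set (zip (tl vs) vs)" if "length vs = n" for vs :: "'a list"
  proof -
    have "{(vs ! i, vs ! j) | i j. i < n \<and> j < n \<and> (j = Suc i \<or> i = Suc j)} =
        {(vs ! i, vs ! Suc i) | i. Suc i < n} \<union> {(vs ! Suc i, vs ! i) | i. Suc i < n}"
      by auto (metis Suc_lessD)+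
    also have "\<dots> = set (zip vs (tl vs)) \<union> set (zip (tl vs) vs)"
      unfolding set_zip using that
      by (intro arg_cong2[of _ _ _ _ "(\<union>)"] Collect_cong ex_cong1) (auto simp: nth_tl)
    finally show ?thesis .
  qed
  then have "(distinct vs \<and> length vs = n \<and> pverts P = set vs \<and>
      parcs P = {(vs ! i, vs ! j) | i j. i < n \<and> j < n \<and> (j = Suc i \<or> i = Suc j)}) \<longleftrightarrow>
      (distinct vs \<and> length vs = n \<and> pverts P = set vs \<and>
      parcs P = set (zip vs (tl vs)) \<union> set (zip (tl vs) vs))" for vs :: "'a list"
    by (intro conj_cong refl) simp
  then show ?thesis unfolding path_graph_def by (rule ex_cong1)
qed

lemma attaching_delete_vertices:
  assumes G: "pair_graph G" and X: "X \<subseteq> pverts G" "a \<in> X" "b \<notin> X" and ab: "(a, b) \<in> parcs G"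
    and cross: "\<And>x y. (x, y) \<in> parcs G \<Longrightarrow> x \<in> X \<Longrightarrow> y \<notin> X \<Longrightarrow> x = a \<and> y = b"
    and P: "pverts P = X" "\<And>x y. (x, y) \<in> parcs P \<longleftrightarrow> (x, y) \<in> parcs G \<and> x \<in> X \<and> y \<in> X"
  shows "attaching G P a (delete_vertices G X) b"
  unfolding attaching_def
proof (intro conjI)
  note D = pair_graphD[OF G]
  show "a \<in> pverts P" "b \<in> pverts (delete_vertices G X)"
    "pverts P \<inter> pverts (delete_vertices G X) = {}"
    using X P D(3)[OF ab] by auto
  show "G = \<lparr>pverts = pverts P \<union> pverts (delete_vertices G X),
      parcs = parcs P \<union> parcs (delete_vertices G X) \<union> {(a, b), (b, a)}\<rparr>"
  proof (rule pair_pre_digraph_eqI)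
    fix x y
    show "(x, y) \<in> parcs G \<longleftrightarrow> (x, y) \<in> parcs \<lparr>pverts = pverts P \<union> pverts (delete_vertices G X),
      parcs = parcs P \<union> parcs (delete_vertices G X) \<union> {(a, b), (b, a)}\<rparr>"
      using cross[of x y] cross[of y x] ab D(5)[of x y] D(5)[OF ab] P(2)[of x y]
      by (cases "x \<in> X"; cases "y \<in> X") auto
  qed (use X P in auto)
qed

text \<open>
  All edges between \<open>X\<close> and the rest end in \<open>b\<close>, so only the conditions at \<open>b\<close> can be lost.
  The two neighbors \<open>c\<close> and \<open>d\<close> keep \<open>b\<close> from becoming a leaf and, if \<open>b\<close> is in \<open>A\<close>, are the two
  neighbors outside \<open>A\<close> that the shape requires.
\<close>

lemma core_tree_delete_vertices:
  assumes T: "core_tree T A" and T': "simple_tree (delete_vertices T X)" and ne: "A - X \<noteq> {}"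
    and cross: "\<And>x y. (x, y) \<in> parcs T \<Longrightarrow> x \<in> X \<Longrightarrow> y \<notin> X \<Longrightarrow> y = b"
    and bX: "b \<notin> X" and two: "c \<noteq> d" "(b, c) \<in> parcs T" "(b, d) \<in> parcs T" "c \<notin> X" "d \<notin> X"
    and bA: "b \<in> A \<Longrightarrow> c \<notin> A \<and> d \<notin> A"
    and leafb: "\<And>l. neighbors T l = {b} \<Longrightarrow> l \<notin> X"
  shows "core_tree (delete_vertices T X) (A - X)"
proof -
  let ?H = "delete_vertices T X"
  note D = pair_graphD[OF core_treeD(2)[OF T]]
  have inner: "y \<notin> X" if "(x, y) \<in> parcs T" "x \<notin> X" "x \<noteq> b" for x y
    using cross[OF D(5)[OF that(1)]] that by blast
  have leaf: "neighbors T l = {p} \<and> l \<notin> X" if l: "neighbors ?H l = {p}" for l p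
  proof -
    have lp: "(l, p) \<in> parcs T" "l \<notin> X" using leaf_arc[OF l] by auto
    have "l \<noteq> b"
    proof
      assume "l = b"
      then have "c = p" "d = p"
        using leaf_arc_unique[OF l, of c] leaf_arc_unique[OF l, of d] two bX by simp_all
      then show False using two by simp
    qed
    have "q = p" if q: "(l, q) \<in> parcs T" for q
      using leaf_arc_unique[OF l, of q] inner[OF q lp(2) \<open>l \<noteq> b\<close>] q lp(2) by simp
    then show ?thesis using neighbors_eq_singletonI[OF lp(1)] lp(2) by blast
  qed
  have unique: "\<exists>!l. neighbors ?H l = {a}" if a: "a \<in> A - X" for a
  proof -
    have "a \<in> A" using a by simp
    obtain l where l: "neighbors T l = {a}" using core_treeD(6)[OF T \<open>a \<in> A\<close>] by blast
    have la: "(l, a) \<in> parcs T" by (rule leaf_arc[OF l])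
    have lX: "l \<notin> X"
    proof
      assume "l \<in> X"
      then have "a = b" using cross[OF la] a by blast
      then show False using leafb l \<open>l \<in> X\<close> by simp
    qed
    have "neighbors ?H l = {a}"
    proof (rule neighbors_eq_singletonI)
      show "(l, a) \<in> parcs ?H" using la lX a by simp
      show "w = a" if "(l, w) \<in> parcs ?H" for w using leaf_arc_unique[OF l, of w] that by simp
    qed
    moreover have "m = l" if "neighbors ?H m = {a}" for m
      by (rule core_treeD(7)[OF T \<open>a \<in> A\<close> conjunct1[OF leaf[OF that]] l])
    ultimately show ?thesis by (rule ex1I)
  qed
  have nbrs: "\<exists>x y. x \<noteq> y \<and> x \<notin> A - X \<and> y \<notin> A - X \<and> (a, x) \<in> parcs ?H \<and> (a, y) \<in> parcs ?H"
    if a: "a \<in> A - X" for a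
  proof (cases "a = b")
    case True
    then show ?thesis using two bA a by (intro exI[of _ c] exI[of _ d]) auto
  next
    case False
    obtain x y where xy: "x \<noteq> y" "x \<notin> A" "y \<notin> A" "(a, x) \<in> parcs T" "(a, y) \<in> parcs T"
      using core_treeD(8)[OF T] a by blast
    then have "x \<notin> X" "y \<notin> X" using inner False a by blast+
    then show ?thesis using xy a by (intro exI[of _ x] exI[of _ y]) auto
  qed
  have "x \<in> A - X \<or> y \<in> A - X" if "(x, y) \<in> parcs ?H" for x y
    using that core_treeD(5)[OF T, of x y] by auto
  moreover have "A - X \<subseteq> pverts ?H" using core_treeD(3)[OF T] by auto
  ultimately show ?thesis
    unfolding core_tree_def by (intro conjI ballI allI impI T' ne unique nbrs)
qed

theorem theorem5:
  fixes T :: "'a::infinite pair_pre_digraph" and r :: nat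
  assumes "maximal_tree T" and "graph_rank T = r" and "r \<ge> 4"
  shows "\<exists>T'. maximal_tree T' \<and> graph_rank T' < r \<and>
    ((graph_rank T' = r - 2 \<and>
        (\<exists>P a b. path_graph 2 P \<and> a \<in> pverts P \<and>
           b \<in> pverts T' \<and> \<not> pendant T' b \<and> \<not> pre_pendant T' b \<and>
           attaching T P a T' b)) \<or>
     (graph_rank T' = r - 2 \<and>
        (\<exists>P a b. path_graph 3 P \<and> pendant P a \<and> pre_pendant T' b \<and>
           attaching T P a T' b)) \<or>
     (r \<ge> 8 \<and> graph_rank T' = r - 4 \<and>
        (\<exists>P a b. path_graph 5 P \<and> pre_pendant P a \<and> pre_pendant T' b \<and>
           attaching T P a T' b)))"
proof -
  define A where "A = {v. pre_pendant T v}"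
  have T: "core_tree T A" unfolding A_def using maximal_tree_core assms by blast
  note tree = core_treeD(1)[OF T] and G = core_treeD(2)[OF T]
  note D = pair_graphD[OF G]
  have finA: "finite A" using core_treeD(3)[OF T] D(1) finite_subset by blast
  have r: "r = 2 * card A" using core_tree_rank[OF T] assms(2) by simp
  obtain h where h: "depth_function T h" using simple_tree_depth_function[OF tree] by blast
  note step = depth_functionD(1)[OF h] and parent = depth_functionD(2)[OF h]
  define k where "k = Max (h ` pverts T)"
  have hk: "h v \<le> k" if "v \<in> pverts T" for v using that D(1) by (simp add: k_def)
  have deep_leaf: "neighbors T v = {p}" if v: "h v = k" "(v, p) \<in> parcs T" for v p
  proof (rule neighbors_eq_singletonI[OF v(2)])
    have up: "h v = Suc (h q)" if "(v, q) \<in> parcs T" for q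
      using step[OF that] hk[OF D(3)[OF that]] v(1) by linarith
    show "q = p" if "(v, q) \<in> parcs T" for q using parent[OF that v(2)] up that v(2) by blast
  qed
  have A_not_leaf: "a \<notin> A" if "neighbors T a = {p}" for a p
    by (rule core_tree_leaf_outside(1)[OF T that])
  have leaf_unique: "l = m" if "neighbors T l = {p}" "neighbors T m = {p}" for l m p
    using core_treeD(7)[OF T core_tree_leaf_outside(2)[OF T that(1)] that] .
  have nA: "b \<in> A" if "(a, b) \<in> parcs T" "a \<notin> A" for a b by (rule core_treeD(5)[OF T that])
  obtain v0 where v0: "v0 \<in> pverts T" "h v0 = k"
  proof -
    have "pverts T \<noteq> {}" using core_treeD(3,4)[OF T] by blast
    then have "k \<in> h ` pverts T" unfolding k_def using D(1) by (intro Max_in) auto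
    then show ?thesis using that by blast
  qed
  obtain v1 where e01: "(v0, v1) \<in> parcs T"
  proof -
    have "neighbors T v0 \<noteq> {}" using core_tree_reduced[OF T] v0 by (simp add: reduced_def)
    then show ?thesis using that by auto
  qed
  have n0: "neighbors T v0 = {v1}" by (rule deep_leaf[OF v0(2) e01])
  have v0A: "v0 \<notin> A" by (rule A_not_leaf[OF n0])
  have v1A: "v1 \<in> A" by (rule nA[OF e01 v0A])
  have h1: "k = Suc (h v1)" using step[OF e01] hk[OF D(3)[OF e01]] v0(2) by linarith
  obtain v2 v3 where v23: "(v1, v2) \<in> parcs T" "v2 \<notin> A" "(v2, v3) \<in> parcs T" "v3 \<noteq> v1" "v3 \<in> A"
    using core_tree_nonleaf_neighbor[OF T v1A] by blast
  \<comment> \<open>\<open>v2\<close> is not a leaf, hence not on the deepest level; so it is the parent of \<open>v1\<close>.\<close>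
  have not_deep: "h v2 \<noteq> k"
  proof
    assume "h v2 = k"
    from leaf_arc_unique[OF deep_leaf[OF this v23(3)] D(5)[OF v23(1)]] show False using v23(4) by simp
  qed
  have h2: "h v1 = Suc (h v2)" using step[OF v23(1)] not_deep h1 by linarith
  \<comment> \<open>Children of \<open>v1\<close> are on the deepest level, hence leaves, and \<open>v1\<close> has only one leaf.\<close>
  have n1: "y = v0 \<or> y = v2" if y: "(v1, y) \<in> parcs T" for y
  proof (cases "h v1 = Suc (h y)")
    case True
    then show ?thesis using parent[OF y v23(1) True h2] by blast
  next
    case False
    then have "h y = k" using step[OF y] h1 by linarith
    then have "neighbors T y = {v1}" by (rule deep_leaf[OF _ D(5)[OF y]])
    from leaf_unique[OF this n0] show ?thesis by simp
  qed
  have e: "(v1, v0) \<in> parcs T" "(v2, v1) \<in> parcs T" "(v3, v2) \<in> parcs T"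
    using D(5) e01 v23 by blast+
  have V: "v0 \<in> pverts T" "v1 \<in> pverts T" "v2 \<in> pverts T" "v3 \<in> pverts T"
    using D(2) e01 e v23 by blast+
  have n0': "y = v1" if "(v0, y) \<in> parcs T" for y by (rule leaf_arc_unique[OF n0 that])
  have v02: "v0 \<noteq> v2" using n0'[of v3] v23 by blast
  have dist: "distinct [v0, v1, v2, v3]" using v02 v0A v1A v23 by auto
  let ?T2 = "delete_vertices T {v0, v1}"
  have tree1: "simple_tree (delete_vertices T {v0})" by (rule simple_tree_delete_leaf[OF tree n0])
  have tree2: "simple_tree ?T2"
  proof -
    have "neighbors (delete_vertices T {v0}) v1 = {v2}"
      using n1 v23 dist by (intro neighbors_eq_singletonI) auto
    from simple_tree_delete_leaf[OF tree1 this] show ?thesis by (simp add: insert_commute)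
  qed
  show ?thesis
  proof (cases "\<exists>v4. (v2, v4) \<in> parcs T \<and> v4 \<noteq> v1 \<and> v4 \<noteq> v3")
    case True
    then obtain v4 where v4: "(v2, v4) \<in> parcs T" "v4 \<noteq> v1" "v4 \<noteq> v3" by blast
    have v40: "v4 \<noteq> v0" using nA[OF v4(1) v23(2)] v0A by blast
    have core: "core_tree ?T2 (A - {v0, v1})"
    proof (rule core_tree_delete_vertices[OF T tree2, of v2 v3 v4])
      show "A - {v0, v1} \<noteq> {}" using v23 dist by auto
      show "y = v2" if "(x, y) \<in> parcs T" "x \<in> {v0, v1}" "y \<notin> {v0, v1}" for x y
        using that n0' n1 by blast
      show "l \<notin> {v0, v1}" if "neighbors T l = {v2}" for l
        using core_tree_leaf_outside(2)[OF T that] v23(2) by blast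
    qed (use v4 v40 v23 dist in auto)
    have "A - {v0, v1} = A - {v1}" using v0A by blast
    then have "card (A - {v0, v1}) = card A - 1" using v1A finA by simp
    then have rank: "graph_rank ?T2 = r - 2" using core_tree_rank[OF core] r by simp
    define P where "P = \<lparr>pverts = {v0, v1}, parcs = {(v0, v1), (v1, v0)}\<rparr>"
    have "path_graph 2 P"
      unfolding path_graph_consecutive using dist by (intro exI[of _ "[v0, v1]"]) (auto simp: P_def)
    moreover have "attaching T P v1 ?T2 v2"
    proof (rule attaching_delete_vertices[OF G])
      show "x = v1 \<and> y = v2" if "(x, y) \<in> parcs T" "x \<in> {v0, v1}" "y \<notin> {v0, v1}" for x y
        using that n0' n1 by blast
      show "(x, y) \<in> parcs P \<longleftrightarrow> (x, y) \<in> parcs T \<and> x \<in> {v0, v1} \<and> y \<in> {v0, v1}" for x y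
        using e01 e D(4)[of x y] by (auto simp: P_def)
    qed (use V dist v23 in \<open>auto simp: P_def\<close>)
    moreover have "\<not> pre_pendant ?T2 v2" using core_tree_pre_pendant_iff[OF core] v23 by blast
    moreover have "\<not> pendant ?T2 v2"
    proof
      assume "pendant ?T2 v2"
      then obtain p where p: "neighbors ?T2 v2 = {p}"
        unfolding pendant_iff[OF core_treeD(2)[OF core]] by blast
      have "v3 = p" "v4 = p"
        using leaf_arc_unique[OF p, of v3] leaf_arc_unique[OF p, of v4] v23 v4 v40 dist by auto
      then show False using v4 by simp
    qed
    moreover have "v2 \<in> pverts ?T2" "v1 \<in> pverts P" using V dist by (auto simp: P_def)
    moreover have "graph_rank ?T2 < r" using rank assms(3) by simp
    ultimately show ?thesis using core_tree_maximal[OF core] rank by blast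
  next
    case False
    then have n2: "y = v1 \<or> y = v3" if "(v2, y) \<in> parcs T" for y using that by blast
    let ?X3 = "{v0, v1, v2}" and ?T3 = "delete_vertices T {v0, v1, v2}"
    have tree3: "simple_tree ?T3"
    proof -
      have "neighbors ?T2 v2 = {v3}"
        using n2 v23 dist by (intro neighbors_eq_singletonI) auto
      from simple_tree_delete_leaf[OF tree2 this] show ?thesis by (simp add: insert_commute)
    qed
    have cross3: "x = v2 \<and> y = v3" if "(x, y) \<in> parcs T" "x \<in> ?X3" "y \<notin> ?X3" for x y
      using that n0' n1 n2 by blast
    have leaf3: "l \<notin> ?X3" if l: "neighbors T l = {v3}" for l
    proof -
      have "l \<noteq> v0" using leaf_arc_unique[OF l, of v1] e01 v23(4) by blast
      moreover have "l \<noteq> v1" using A_not_leaf[OF l] v1A by blast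
      moreover have "l \<noteq> v2" using leaf_arc_unique[OF l, of v1] e v23(4) by blast
      ultimately show ?thesis by blast
    qed
    define P3 where "P3 = \<lparr>pverts = {v0, v1, v2}, parcs = {(v0, v1), (v1, v0), (v1, v2), (v2, v1)}\<rparr>"
    have path3: "path_graph 3 P3"
      unfolding path_graph_consecutive using dist
      by (intro exI[of _ "[v0, v1, v2]"]) (auto simp: P3_def)
    have pend3: "pendant P3 v2"
    proof -
      have "pair_graph P3" using dist by (auto simp: P3_def pair_graph_iff)
      moreover have "neighbors P3 v2 = {v1}" using dist by (auto simp: P3_def)
      ultimately show ?thesis by (simp add: pendant_iff)
    qed
    have e02: "(v0, v2) \<notin> parcs T" "(v2, v0) \<notin> parcs T" using n0' n2 dist by auto
    have attach3: "attaching T P3 v2 ?T3 v3"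
    proof (rule attaching_delete_vertices[OF G])
      show "(x, y) \<in> parcs P3 \<longleftrightarrow> (x, y) \<in> parcs T \<and> x \<in> ?X3 \<and> y \<in> ?X3" for x y
        using e01 e v23 e02 D(4)[of x y] by (auto simp: P3_def)
      show "x = v2 \<and> y = v3" if "(x, y) \<in> parcs T" "x \<in> ?X3" "y \<notin> ?X3" for x y
        by (rule cross3[OF that])
    qed (use V dist v23 in \<open>auto simp: P3_def\<close>)
    obtain w where w: "neighbors T w = {v3}" using core_treeD(6)[OF T v23(5)] by blast
    have wA: "w \<notin> A" and wX: "w \<notin> ?X3" using A_not_leaf[OF w] leaf3[OF w] by auto
    have w3: "(w, v3) \<in> parcs T" "(v3, w) \<in> parcs T" using leaf_arc[OF w] D(5) by blast+
    have wV: "w \<in> pverts T" "w \<noteq> v3" using D(2,4)[OF w3(1)] by auto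
    have nw: "y = v3" if "(w, y) \<in> parcs T" for y by (rule leaf_arc_unique[OF w that])
    have nw': "neighbors ?T3 w = {v3}"
    proof (rule neighbors_eq_singletonI)
      show "(w, v3) \<in> parcs ?T3" using w3 wX dist by auto
      show "y = v3" if "(w, y) \<in> parcs ?T3" for y using nw[of y] that by simp
    qed
    have card3: "card (A - ?X3) = card A - 1"
    proof -
      have "A - ?X3 = A - {v1}" using v0A v23(2) by blast
      then show ?thesis using v1A finA by simp
    qed
    show ?thesis
    proof (cases "\<exists>d. (v3, d) \<in> parcs T \<and> d \<notin> A \<and> d \<noteq> v2 \<and> d \<noteq> w")
      case True
      then obtain d where d: "(v3, d) \<in> parcs T" "d \<notin> A" "d \<noteq> v2" "d \<noteq> w" by blast
      have d0: "d \<noteq> v0" using n0'[of v3] D(5)[OF d(1)] v23(4) by blast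
      have core: "core_tree ?T3 (A - ?X3)"
      proof (rule core_tree_delete_vertices[OF T tree3, of v3 d w])
        show "A - ?X3 \<noteq> {}" using v23 dist by auto
        show "y = v3" if "(x, y) \<in> parcs T" "x \<in> ?X3" "y \<notin> ?X3" for x y
          using cross3[OF that] by blast
        show "l \<notin> ?X3" if "neighbors T l = {v3}" for l by (rule leaf3[OF that])
        show "d \<notin> ?X3" using d d0 v1A by blast
      qed (use d w3 wA wX dist in auto)
      have rank: "graph_rank ?T3 = r - 2" using core_tree_rank[OF core] r card3 by simp
      moreover have "pre_pendant ?T3 v3"
        using core_tree_pre_pendant_iff[OF core] v23 dist by auto
      moreover have "graph_rank ?T3 < r" using rank assms(3) by simp
      ultimately show ?thesis
        using core_tree_maximal[OF core] path3 pend3 attach3 by blast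
    next
      case False
      then have n3: "y \<in> A \<or> y = v2 \<or> y = w" if "(v3, y) \<in> parcs T" for y using that by blast
      \<comment> \<open>Of two neighbors of \<open>v3\<close> in \<open>A\<close>, one is a child \<open>z\<close>. It has a non-leaf neighbor \<open>d\<close> outside \<open>A\<close>, which is
        a child of \<open>z\<close> and has in turn a child \<open>f\<close> in \<open>A\<close>. But \<open>f\<close> would be on the deepest level, hence a leaf.\<close>
      have one: "x = x'" if x: "(v3, x) \<in> parcs T" "x \<in> A" "(v3, x') \<in> parcs T" "x' \<in> A" for x x'
      proof (rule ccontr)
        assume "x \<noteq> x'"
        then have "\<not> (h v3 = Suc (h x) \<and> h v3 = Suc (h x'))" using parent[OF x(1,3)] by blast
        then obtain z where z: "(v3, z) \<in> parcs T" "z \<in> A" "h z = Suc (h v3)"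
          using step[OF x(1)] step[OF x(3)] x by blast
        have zk: "h z \<noteq> k" using deep_leaf[OF _ D(5)[OF z(1)]] A_not_leaf z(2) by blast
        then have h3: "h v2 = Suc (h v3)" using step[OF v23(3)] z(3) h1 h2 by linarith
        obtain d f where d: "(z, d) \<in> parcs T" "d \<notin> A" "(d, f) \<in> parcs T" "f \<noteq> z" "f \<in> A"
          using core_tree_nonleaf_neighbor[OF T z(2)] by blast
        have "\<not> h z = Suc (h d)" using parent[OF d(1) D(5)[OF z(1)]] z(3) d(2) v23(5) by blast
        then have hd: "h d = Suc (h z)" using step[OF d(1)] by blast
        have "\<not> h d = Suc (h f)" using parent[OF d(3) D(5)[OF d(1)]] hd d(4) by blast
        then have "h f = k" using step[OF d(3)] hd z(3) h3 h2 h1 by linarith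
        then show False using deep_leaf[OF _ D(5)[OF d(3)]] A_not_leaf d(5) by blast
      qed
      show ?thesis
      proof (cases "\<exists>x. (v3, x) \<in> parcs T \<and> x \<in> A")
        case False
        then have n3': "y = v2 \<or> y = w" if "(v3, y) \<in> parcs T" for y using n3[OF that] that by blast
        have all: "pverts T \<subseteq> {v0, v1, v2, v3, w}"
        proof (rule ccontr)
          assume "\<not> ?thesis"
          then obtain x y where "(x, y) \<in> parcs T" "x \<in> {v0, v1, v2, v3, w}" "y \<notin> {v0, v1, v2, v3, w}"
            using simple_tree_cut[OF tree, of "{v0, v1, v2, v3, w}"] V by blast
          then show False using n0' n1 n2 n3' nw by blast
        qed
        have "?T3 = \<lparr>pverts = {v3, w}, parcs = {(v3, w), (w, v3)}\<rparr>"
        proof (rule pair_pre_digraph_eqI)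
          fix x y
          show "(x, y) \<in> parcs ?T3 \<longleftrightarrow> (x, y) \<in> parcs \<lparr>pverts = {v3, w}, parcs = {(v3, w), (w, v3)}\<rparr>"
            using w3 wX wV dist all D(2,3,4)[of x y] by auto
        qed (use all V wV wX dist in auto)
        then have edge: "maximal_tree ?T3" "graph_rank ?T3 = 2"
          using edge_maximal_tree[of v3 w] wV by simp_all
        have "A \<subseteq> {v1, v3}" using all core_treeD(3)[OF T] v0A v23(2) wA by blast
        then have "A = {v1, v3}" using v1A v23 by blast
        then have "r = 4" using r dist by simp
        moreover have "pre_pendant ?T3 v3"
          unfolding pre_pendant_iff[OF simple_tree_pair_graph[OF tree3]] using nw' by blast
        ultimately show ?thesis using edge path3 pend3 attach3 by auto
      next
        case True
        then obtain x where x: "(v3, x) \<in> parcs T" "x \<in> A" by blast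
        have n3': "y = v2 \<or> y = w \<or> y = x" if "(v3, y) \<in> parcs T" for y
          using n3[OF that] one[OF that _ x] by blast
        let ?X5 = "{v0, v1, v2, v3, w}" and ?T5 = "delete_vertices T {v0, v1, v2, v3, w}"
        have xX: "x \<notin> ?X5"
          using x v0A v23(2) wA D(4)[OF x(1)] n1[of v3] D(5)[OF x(1)] dist by auto
        have cross5: "p = v3 \<and> q = x" if "(p, q) \<in> parcs T" "p \<in> ?X5" "q \<notin> ?X5" for p q
          using that n0' n1 n2 n3' nw by blast
        have tree5: "simple_tree ?T5"
        proof -
          from simple_tree_delete_leaf[OF tree3 nw']
          have t4: "simple_tree (delete_vertices T {v0, v1, v2, w})" by (simp add: insert_commute)
          have "neighbors (delete_vertices T {v0, v1, v2, w}) v3 = {x}"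
          proof (rule neighbors_eq_singletonI)
            show "(v3, x) \<in> parcs (delete_vertices T {v0, v1, v2, w})" using x xX dist wV by auto
            show "y = x" if "(v3, y) \<in> parcs (delete_vertices T {v0, v1, v2, w})" for y
              using n3'[of y] that by auto
          qed
          from simple_tree_delete_leaf[OF t4 this] show ?thesis by (simp add: insert_commute)
        qed
        obtain c d where cd: "c \<noteq> d" "c \<notin> A" "d \<notin> A" "(x, c) \<in> parcs T" "(x, d) \<in> parcs T"
          using core_treeD(8)[OF T x(2)] by blast
        have out: "c \<notin> ?X5" if "(x, c) \<in> parcs T" "c \<notin> A" for c
          using cross5[OF D(5)[OF that(1)]] xX that(2) v23(5) by blast
        have core: "core_tree ?T5 (A - ?X5)"
        proof (rule core_tree_delete_vertices[OF T tree5, of x c d])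
          show "A - ?X5 \<noteq> {}" using x(2) xX by blast
          show "q = x" if "(p, q) \<in> parcs T" "p \<in> ?X5" "q \<notin> ?X5" for p q
            using cross5[OF that] by blast
          show "l \<notin> ?X5" if l: "neighbors T l = {x}" for l
            by (rule out[OF D(5)[OF leaf_arc[OF l]] A_not_leaf[OF l]])
          show "c \<notin> ?X5" "d \<notin> ?X5" using out cd by blast+
        qed (use cd xX in auto)
        have "A - ?X5 = A - {v1, v3}" using v0A v23(2) wA by blast
        moreover have "card (A - {v1, v3}) = card A - 2"
          using v1A v23(5) dist finA by (subst card_Diff_subset) auto
        ultimately have card5: "card (A - ?X5) = card A - 2" by simp
        \<comment> \<open>The remaining tree has the required shape, and \<open>x\<close> is not its only vertex in \<open>A\<close>: a non-leaf neighbor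
          of \<open>x\<close> outside \<open>A\<close> leads to a second one.\<close>
        have "2 \<le> card (A - ?X5)"
        proof -
          have "x \<in> A - ?X5" using x(2) xX by blast
          from core_tree_nonleaf_neighbor[OF core this] obtain f where "f \<noteq> x" "f \<in> A - ?X5"
            by blast
          then have "{x, f} \<subseteq> A - ?X5" "card {x, f} = 2" using x(2) xX by auto
          then show ?thesis using card_mono[of "A - ?X5" "{x, f}"] finA by simp
        qed
        then have r8: "r \<ge> 8" using r card5 by simp
        have rank: "graph_rank ?T5 = r - 4" using core_tree_rank[OF core] r card5 by simp
        define P where "P = \<lparr>pverts = {v0, v1, v2, v3, w}, parcs =
          {(v0, v1), (v1, v0), (v1, v2), (v2, v1), (v2, v3), (v3, v2), (v3, w), (w, v3)}\<rparr>"
        have dist5: "distinct [v0, v1, v2, v3, w]" using dist wX wV by auto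
        have "path_graph 5 P"
          unfolding path_graph_consecutive using dist5
          by (intro exI[of _ "[v0, v1, v2, v3, w]"]) (auto simp: P_def)
        moreover have "pre_pendant P v3"
        proof -
          have "pair_graph P" using dist5 by (auto simp: P_def pair_graph_iff)
          moreover have "neighbors P w = {v3}" using dist5 by (auto simp: P_def)
          ultimately show ?thesis using pre_pendant_iff[of P v3] by blast
        qed
        moreover have "attaching T P v3 ?T5 x"
        proof (rule attaching_delete_vertices[OF G])
          show "(p, q) \<in> parcs P \<longleftrightarrow> (p, q) \<in> parcs T \<and> p \<in> ?X5 \<and> q \<in> ?X5" for p q
          proof
            assume "(p, q) \<in> parcs P"
            then show "(p, q) \<in> parcs T \<and> p \<in> ?X5 \<and> q \<in> ?X5"
              using e01 e v23 w3 by (auto simp: P_def)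
          next
            assume "(p, q) \<in> parcs T \<and> p \<in> ?X5 \<and> q \<in> ?X5"
            then have "p = v0 \<and> q = v1 \<or> p = v1 \<and> (q = v0 \<or> q = v2) \<or>
                p = v2 \<and> (q = v1 \<or> q = v3) \<or> p = v3 \<and> (q = v2 \<or> q = w) \<or> p = w \<and> q = v3"
              using n0' n1 n2 n3' nw xX by blast
            then show "(p, q) \<in> parcs P" unfolding P_def by (elim disjE conjE) simp_all
          qed
          show "p = v3 \<and> q = x" if "(p, q) \<in> parcs T" "p \<in> ?X5" "q \<notin> ?X5" for p q
            by (rule cross5[OF that])
        qed (use V wV dist5 x xX in \<open>auto simp: P_def\<close>)
        moreover have "pre_pendant ?T5 x"
          using core_tree_pre_pendant_iff[OF core] x(2) xX by blast
        moreover have "graph_rank ?T5 < r" using rank r8 by simp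
        ultimately show ?thesis using core_tree_maximal[OF core] rank r8 by blast
      qed
    qed
  qed
qed

end
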